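(* The lattice $L(\mathbf A')$ of all subvarieties of the monoid variety $\mathbf A'$ is distributive.
   Context: Monoids are considered as semigroups with an additional 0-ary operation fixing the identity element; varieties are varieties of such algebras. $\mathbb N=\{1,2,\dots\}$, $\mathbb N_0=\mathbb N\cup\{0\}$. $S_n$ is the symmetric group on $\{1,\dots,n\}$ (with $S_0=S_1$); permutations act on the right ($i\mapsto i\rho$). Different letter symbols denote distinct letters; empty products are the empty word. For $n\in\mathbb N$ and $\pi,\tau\in S_n$: $\mathbf w_n[\pi,\tau]=\bigl(\prod_{i=1}^n z_it_i\bigr)x\bigl(\prod_{i=1}^n z_{i\pi}z_{n+i\tau}\bigr)x\bigl(\prod_{i=n+1}^{2n} t_iz_i\bigr)$, $\mathbf w_n'[\pi,\tau]=\bigl(\prod_{i=1}^n z_it_i\bigr)x^2\bigl(\prod_{i=1}^n z_{i\pi}z_{n+i\tau}\bigr)\bigl(\prod_{i=n+1}^{2n} t_iz_i\bigr)$. For $n,m,k\in\mathbb N_0$ and $\rho\in S_{n+m+k}$: $\mathbf c_{n,m,k}[\rho]=\bigl(\prod_{i=1}^n z_it_i\bigr)xyt\bigl(\prod_{i=n+1}^{n+m} z_it_i\bigr)x\bigl(\prod_{i=1}^{n+m+k} z_{i\rho}\bigr)y\bigl(\prod_{i=n+m+1}^{n+m+k} t_iz_i\bigr)$, $\mathbf c_{n,m,k}'[\rho]=\bigl(\prod_{i=1}^n z_it_i\bigr)yxt\bigl(\prod_{i=n+1}^{n+m} z_it_i\bigr)x\bigl(\prod_{i=1}^{n+m+k}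 z_{i\rho}\bigr)y\bigl(\prod_{i=n+m+1}^{n+m+k} t_iz_i\bigr)$; $\mathbf d_{n,m,k}[\rho]$, $\mathbf d_{n,m,k}'[\rho]$ are the words obtained from $\mathbf c_{n,m,k}[\rho]$, $\mathbf c_{n,m,k}'[\rho]$ respectively by reading them from right to left. $\mathbf A'$ is the monoid variety given by the identities $x^2\approx x^3$, $x^2y\approx yx^2$, all $\mathbf w_n[\pi,\tau]\approx\mathbf w_n'[\pi,\tau]$ with $n\in\mathbb N$, $\pi,\tau\in S_n$, and all $\mathbf c_{n,m,k}[\rho]\approx\mathbf c_{n,m,k}'[\rho]$ and $\mathbf d_{n,m,k}[\rho]\approx\mathbf d_{n,m,k}'[\rho]$ with $n,m,k\in\mathbb N_0$, $\rho\in S_{n+m+k}$. *)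

theory Defs
  imports "HOL-Algebra.Group" "HOL-Combinatorics.Permutations"
begin

section \<open>Words and monoid identities\<close>

text \<open>
  A countably infinite alphabet. The letters occurring in the defining identities of the variety
  are pairwise distinct: \<open>Lx\<close>, \<open>Ly\<close>, \<open>Lt\<close> stand for \<open>x\<close>, \<open>y\<close>, \<open>t\<close>, and \<open>Lti i\<close>, \<open>Lzi i\<close> for
  \<open>t\<^sub>i\<close>, \<open>z\<^sub>i\<close>. As the alphabet is countably infinite, every monoid identity can be written
  over it after renaming letters.
\<close>

datatype letter = Lx | Ly | Lt | Lti nat | Lzi nat

type_synonym word = "letter list"

type_synonym identity = "word \<times> word"

definition word_value :: "('a, 'b) monoid_scheme \<Rightarrow> (letter \<Rightarrow> 'a) \<Rightarrow> word \<Rightarrow> 'a"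
  where "word_value M \<phi> w = foldr (\<lambda>l a. \<phi> l \<otimes>\<^bsub>M\<^esub> a) w \<one>\<^bsub>M\<^esub>"

definition satisfies :: "('a, 'b) monoid_scheme \<Rightarrow> identity \<Rightarrow> bool"
  where "satisfies M e \<longleftrightarrow>
    (\<forall>\<phi> \<in> UNIV \<rightarrow> carrier M. word_value M \<phi> (fst e) = word_value M \<phi> (snd e))"


section \<open>Varieties of monoids and lattices of subvarieties\<close>

text \<open>
  HOL cannot form the class of all monoids over all types, so a variety is represented by the set
  of its members whose carrier is a subset of a type \<open>'a\<close>. If \<open>'a\<close> is infinite, no information is
  lost: a variety is determined by its free monoid of countably infinite rank, which is
  countable and hence has an isomorphic copy with carrier in \<open>'a\<close>. So inclusion of varieties
  agrees with inclusion of the sets representing them.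
\<close>

definition variety_of :: "identity set \<Rightarrow> 'a monoid set"
  where "variety_of \<Sigma> = {M. monoid M \<and> (\<forall>e\<in>\<Sigma>. satisfies M e)}"

definition monoid_variety :: "'a monoid set \<Rightarrow> bool"
  where "monoid_variety \<V> \<longleftrightarrow> (\<exists>\<Sigma>. \<V> = variety_of \<Sigma>)"

definition subvarieties :: "'a monoid set \<Rightarrow> 'a monoid set gorder"
  where "subvarieties \<V> =
    \<lparr>carrier = {\<W>. monoid_variety \<W> \<and> \<W> \<subseteq> \<V>}, eq = (=), le = (\<subseteq>)\<rparr>"

locale distributive_lattice = lattice +
  assumes meet_join_distrib:
    "\<lbrakk>x \<in> carrier L; y \<in> carrier L; z \<in> carrier L\<rbrakk>
      \<Longrightarrow> x \<sqinter> (y \<squnion> z) = (x \<sqinter> y) \<squnion> (x \<sqinter> z)"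


section \<open>The variety \<open>A'\<close>\<close>

text \<open>
  \<open>word_prod a b f\<close> is the product of the words \<open>f i\<close> for \<open>i = a, \<dots>, b\<close> (empty if \<open>b < a\<close>).
  Permutations act on the right, so the index \<open>i\<rho>\<close> is \<open>\<rho> i\<close>.
\<close>

definition word_prod :: "nat \<Rightarrow> nat \<Rightarrow> (nat \<Rightarrow> word) \<Rightarrow> word"
  where "word_prod a b f = concat (map f [a..<Suc b])"

definition w_word :: "nat \<Rightarrow> (nat \<Rightarrow> nat) \<Rightarrow> (nat \<Rightarrow> nat) \<Rightarrow> word"
  where "w_word n \<pi> \<tau> =
    word_prod 1 n (\<lambda>i. [Lzi i, Lti i]) @ [Lx] @
    word_prod 1 n (\<lambda>i. [Lzi (\<pi> i), Lzi (n + \<tau> i)]) @ [Lx] @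
    word_prod (n + 1) (2 * n) (\<lambda>i. [Lti i, Lzi i])"

definition w_word' :: "nat \<Rightarrow> (nat \<Rightarrow> nat) \<Rightarrow> (nat \<Rightarrow> nat) \<Rightarrow> word"
  where "w_word' n \<pi> \<tau> =
    word_prod 1 n (\<lambda>i. [Lzi i, Lti i]) @ [Lx, Lx] @
    word_prod 1 n (\<lambda>i. [Lzi (\<pi> i), Lzi (n + \<tau> i)]) @
    word_prod (n + 1) (2 * n) (\<lambda>i. [Lti i, Lzi i])"

definition c_word :: "nat \<Rightarrow> nat \<Rightarrow> nat \<Rightarrow> (nat \<Rightarrow> nat) \<Rightarrow> word"
  where "c_word n m k \<rho> =
    word_prod 1 n (\<lambda>i. [Lzi i, Lti i]) @ [Lx, Ly, Lt] @
    word_prod (n + 1) (n + m) (\<lambda>i. [Lzi i, Lti i]) @ [Lx] @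
    word_prod 1 (n + m + k) (\<lambda>i. [Lzi (\<rho> i)]) @ [Ly] @
    word_prod (n + m + 1) (n + m + k) (\<lambda>i. [Lti i, Lzi i])"

definition c_word' :: "nat \<Rightarrow> nat \<Rightarrow> nat \<Rightarrow> (nat \<Rightarrow> nat) \<Rightarrow> word"
  where "c_word' n m k \<rho> =
    word_prod 1 n (\<lambda>i. [Lzi i, Lti i]) @ [Ly, Lx, Lt] @
    word_prod (n + 1) (n + m) (\<lambda>i. [Lzi i, Lti i]) @ [Lx] @
    word_prod 1 (n + m + k) (\<lambda>i. [Lzi (\<rho> i)]) @ [Ly] @
    word_prod (n + m + 1) (n + m + k) (\<lambda>i. [Lti i, Lzi i])"

definition d_word :: "nat \<Rightarrow> nat \<Rightarrow> nat \<Rightarrow> (nat \<Rightarrow> nat) \<Rightarrow> word"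
  where "d_word n m k \<rho> = rev (c_word n m k \<rho>)"

definition d_word' :: "nat \<Rightarrow> nat \<Rightarrow> nat \<Rightarrow> (nat \<Rightarrow> nat) \<Rightarrow> word"
  where "d_word' n m k \<rho> = rev (c_word' n m k \<rho>)"

definition A'_identities :: "identity set"
  where "A'_identities =
    {([Lx, Lx], [Lx, Lx, Lx]), ([Lx, Lx, Ly], [Ly, Lx, Lx])}
    \<union> {(w_word n \<pi> \<tau>, w_word' n \<pi> \<tau>) | n \<pi> \<tau>.
         1 \<le> n \<and> \<pi> permutes {1..n} \<and> \<tau> permutes {1..n}}
    \<union> {(c_word n m k \<rho>, c_word' n m k \<rho>) | n m k \<rho>. \<rho> permutes {1..n + m + k}}
    \<union> {(d_word n m k \<rho>, d_word' n m k \<rho>) | n m k \<rho>. \<rho> permutes {1..n + m + k}}"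

definition variety_A' :: "'a monoid set"
  where "variety_A' = variety_of A'_identities"

end

theory Submission
  imports Defs "HOL-Library.Countable"
begin

text \<open>
  Subvarieties of \<open>A'\<close> correspond to fully invariant congruences on words (theories) containing
  \<open>A'_identities\<close>. Call \<open>(w, w')\<close> an isoterm pair if in every such theory either \<open>w \<approx> w'\<close> holds or
  \<open>w\<close> is alone in its class. An isoterm pair that holds in the intersection of two subvarieties
  holds in one of them, since otherwise \<open>w\<close> is alone in its class for the join of the two
  congruences as well. Hence the lattice is distributive as soon as every theory is determined by
  the isoterm pairs it contains.

  Blocks are the maximal factors of a word without simple letters. Using the identities
  \<open>w_n[\<pi>,\<tau>]\<close>, a letter that occurs twice in a block can be pulled out as a central square. Using
  \<open>c_{n,m,k}[\<rho>]\<close> and \<open>d_{n,m,k}[\<rho>]\<close>, two adjacent letters of a block can be exchanged if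
  they both occur in another block. So, apart from the degenerate theories given by \<open>1 \<approx> x\<close>,
  \<open>x \<approx> x\<^sup>2\<close> and \<open>xy \<approx> yx\<close>, a theory is determined by two kinds of identities:
  \<open>x t\<^sub>1 x \<dots> t\<^sub>m x \<approx> x\<^sup>2 t\<^sub>1 \<dots> t\<^sub>m\<close>, which decides how many occurrences make a letter a square, and
  \<open>a\<^sub>1t\<^sub>1 \<dots> a\<^sub>rt\<^sub>r xy s\<^sub>1b\<^sub>1 \<dots> s\<^sub>lb\<^sub>l \<approx> a\<^sub>1t\<^sub>1 \<dots> a\<^sub>rt\<^sub>r yx s\<^sub>1b\<^sub>1 \<dots> s\<^sub>lb\<^sub>l\<close>
  with \<open>a\<^sub>i, b\<^sub>j \<in> {x, y}\<close>, which allows one to exchange \<open>x\<close> and \<open>y\<close> in a block that is the only common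
  one. All these are isoterm pairs.
\<close>

section \<open>Substitutions and theories containing the identities of the variety\<close>

instance letter :: countable by countable_datatype

definition subst :: "(letter \<Rightarrow> word) \<Rightarrow> word \<Rightarrow> word"
  where "subst s w = concat (map s w)"

lemma subst_simps [simp]:
  "subst s [] = []" "subst s (a # w) = s a @ subst s w" "subst s (u @ v) = subst s u @ subst s v"
  by (simp_all add: subst_def)

lemma subst_rev: "subst s (rev w) = rev (subst (\<lambda>a. rev (s a)) w)"
  by (induction w) auto

lemma subst_word_prod: "subst s (word_prod a b f) = concat (map (\<lambda>i. subst s (f i)) [a..<Suc b])"
proof -
  have "subst s (concat ws) = concat (map (subst s) ws)" for ws
    by (induction ws) auto
  then show ?thesis
    by (simp add: word_prod_def comp_def del: upt_Suc)
qed

lemma subst_delete: "subst (\<lambda>a. if P a then [a] else []) w = filter P w"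
  by (induction w) auto

text \<open>Lets instances of the defining identities be stated with multisets instead of
  permutations. The permutation of list positions is shifted by one, since the letters are indexed
  from 1.\<close>

lemma mset_eq_obtain_permutation:
  assumes "mset p = mset q"
  obtains \<rho> where "\<rho> permutes {1..length p}"
    and "\<And>i. 1 \<le> i \<Longrightarrow> i \<le> length p \<Longrightarrow> 1 \<le> \<rho> i \<and> \<rho> i \<le> length p \<and> q ! (\<rho> i - 1) = p ! (i - 1)"
proof -
  obtain f where f: "f permutes {..<length q}" "permute_list f q = p"
    using mset_eq_permutation[OF assms] by blast
  have len: "length q = length p"
    using assms mset_eq_length by metis
  define \<rho> where "\<rho> i = (if i \<in> {1..length p} then Suc (f (i - 1)) else i)" for i
  have range: "f j < length p" if "j < length p" for j
    using f(1) that len permutes_in_image[of f "{..<length q}" j] by auto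
  have "inj_on \<rho> {1..length p}"
  proof (rule inj_onI)
    fix i j assume "i \<in> {1..length p}" "j \<in> {1..length p}" "\<rho> i = \<rho> j"
    then have "f (i - 1) = f (j - 1)"
      by (simp add: \<rho>_def)
    then have "i - 1 = j - 1"
      using permutes_inj[OF f(1)] by (simp add: inj_eq)
    then show "i = j"
      using \<open>i \<in> _\<close> \<open>j \<in> _\<close> by auto
  qed
  moreover have "\<rho> ` {1..length p} \<subseteq> {1..length p}"
  proof safe
    fix i assume "i \<in> {1..length p}"
    moreover from this have "f (i - 1) < length p" by (intro range) auto
    ultimately show "\<rho> i \<in> {1..length p}" by (simp add: \<rho>_def)
  qed
  ultimately have "bij_betw \<rho> {1..length p} {1..length p}"
    by (simp add: bij_betw_def endo_inj_surj)
  then have "\<rho> permutes {1..length p}"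
    by (rule bij_imp_permutes) (unfold \<rho>_def, rule if_not_P)
  moreover have "1 \<le> \<rho> i \<and> \<rho> i \<le> length p \<and> q ! (\<rho> i - 1) = p ! (i - 1)"
    if "1 \<le> i" "i \<le> length p" for i
  proof -
    have "i - 1 < length p" using that by auto
    moreover have "p ! (i - 1) = q ! f (i - 1)"
      using f permute_list_nth[OF f(1), of "i - 1"] \<open>i - 1 < length p\<close> len by auto
    ultimately show ?thesis
      using that range[of "i - 1"] by (auto simp: \<rho>_def)
  qed
  ultimately show ?thesis
    by (rule that)
qed

lemma map_nth_upt:
  assumes "b = a + length xs" "\<And>i. i < length xs \<Longrightarrow> G (a + i) = F (xs ! i)"
  shows "map G [a..<b] = map F xs"
  using assms by (intro nth_equalityI) auto

locale A'_theory =
  fixes E :: "word \<Rightarrow> word \<Rightarrow> bool"  (infix "\<approx>" 50)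
  assumes refl [simp, intro!]: "u \<approx> u"
    and sym: "u \<approx> v \<Longrightarrow> v \<approx> u"
    and trans [trans]: "u \<approx> v \<Longrightarrow> v \<approx> w \<Longrightarrow> u \<approx> w"
    and cong: "u \<approx> v \<Longrightarrow> p @ u @ q \<approx> p @ v @ q"
    and substI: "u \<approx> v \<Longrightarrow> subst s u \<approx> subst s v"
    and ax: "(u, v) \<in> A'_identities \<Longrightarrow> u \<approx> v"
begin

lemma cong_append: "u \<approx> u' \<Longrightarrow> v \<approx> v' \<Longrightarrow> u @ v \<approx> u' @ v'"
  using cong[of u u' "[]" v] cong[of v v' u' "[]"] trans by auto

lemma delete: "u \<approx> v \<Longrightarrow> filter P u \<approx> filter P v"
  using substI[of u v "\<lambda>a. if P a then [a] else []"] by (simp add: subst_delete)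

lemma square_commute: "X @ X @ Y \<approx> Y @ X @ X"
  using substI[OF ax, of "[Lx, Lx, Ly]" "[Ly, Lx, Lx]" "\<lambda>a. if a = Lx then X else Y"]
  by (simp add: A'_identities_def)

lemma cube: "X @ X \<approx> X @ X @ X"
  using substI[OF ax, of "[Lx, Lx]" "[Lx, Lx, Lx]" "\<lambda>a. X"]
  by (simp add: A'_identities_def)

text \<open>An instance of \<open>w_word\<close>: the left letters \<open>Lzi i\<close> become
  \<open>f a\<close>, the right ones \<open>g a\<close>. With two functions, one of the two values
  can be made empty, which frees \<open>p\<close> from the strict alternation of left and right
  letters.\<close>

lemma w_generic:
  assumes qs: "mset (map fst qs) = mset p" and rs: "mset (map fst rs) = mset p"
  shows "concat (map (\<lambda>(a, t). f a @ t) qs) @ X @ concat (map (\<lambda>a. f a @ g a) p) @ X @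
         concat (map (\<lambda>(a, t). t @ g a) rs)
       \<approx> concat (map (\<lambda>(a, t). f a @ t) qs) @ X @ X @ concat (map (\<lambda>a. f a @ g a) p) @
         concat (map (\<lambda>(a, t). t @ g a) rs)"
proof (cases "p = []")
  case True
  then show ?thesis using assms by simp
next
  case False
  define n where "n = length p"
  have n: "1 \<le> n" using False by (cases p) (auto simp: n_def)
  have len: "length qs = n" "length rs = n"
    using mset_eq_length[OF qs] mset_eq_length[OF rs] by (auto simp: n_def)
  obtain \<pi> where \<pi>: "\<pi> permutes {1..n}"
    "\<And>i. 1 \<le> i \<Longrightarrow> i \<le> n \<Longrightarrow> 1 \<le> \<pi> i \<and> \<pi> i \<le> n \<and> map fst qs ! (\<pi> i - 1) = p ! (i - 1)"
    using mset_eq_obtain_permutation[OF qs[symmetric]] unfolding n_def by metis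
  obtain \<tau> where \<tau>: "\<tau> permutes {1..n}"
    "\<And>i. 1 \<le> i \<Longrightarrow> i \<le> n \<Longrightarrow> 1 \<le> \<tau> i \<and> \<tau> i \<le> n \<and> map fst rs ! (\<tau> i - 1) = p ! (i - 1)"
    using mset_eq_obtain_permutation[OF rs[symmetric]] unfolding n_def by metis
  \<comment> \<open>List positions start at 0 and the entries of \<open>rs\<close> serve the indices
    from \<open>n + 1\<close> on, hence the subtractions.\<close>
  define s where "s a = (case a of
      Lzi i \<Rightarrow> if i \<le> n then f (fst (qs ! (i - 1))) else g (fst (rs ! (i - n - 1)))
    | Lti i \<Rightarrow> if i \<le> n then snd (qs ! (i - 1)) else snd (rs ! (i - n - 1))
    | _ \<Rightarrow> X)" for a
  have L: "map (\<lambda>i. subst s [Lzi i, Lti i]) [1..<Suc n] = map (\<lambda>(a, t). f a @ t) qs"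
    by (rule map_nth_upt) (auto simp: s_def len split: prod.split)
  have R: "map (\<lambda>i. subst s [Lti i, Lzi i]) [n+1..<Suc (2*n)] = map (\<lambda>(a, t). t @ g a) rs"
    by (rule map_nth_upt) (auto simp: s_def len split: prod.split)
  have M: "map (\<lambda>i. subst s [Lzi (\<pi> i), Lzi (n + \<tau> i)]) [1..<Suc n] = map (\<lambda>a. f a @ g a) p"
  proof (rule map_nth_upt)
    fix i assume "i < length p"
    then have i: "1 \<le> Suc i" "Suc i \<le> n" by (auto simp: n_def)
    show "subst s [Lzi (\<pi> (1 + i)), Lzi (n + \<tau> (1 + i))] = f (p ! i) @ g (p ! i)"
      using \<pi>(2)[OF i] \<tau>(2)[OF i] by (auto simp: s_def len)
  qed (simp add: n_def)
  have "(w_word n \<pi> \<tau>, w_word' n \<pi> \<tau>) \<in> A'_identities"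
    using n \<pi>(1) \<tau>(1) unfolding A'_identities_def by blast
  from substI[OF ax[OF this], of s] show ?thesis
    by (simp only: w_word_def w_word'_def subst_simps(3) subst_word_prod L R M) (simp add: s_def)
qed

text \<open>The mirror image comes along because \<open>d_word\<close> is the reversal of
  \<open>c_word\<close>: substituting reversed values into a reversed word reverses the
  result.\<close>

lemma c_generic:
  fixes X Y T :: word
  assumes p: "mset (map fst qs1 @ map fst qs2 @ map fst rs) = mset p"
  defines "u \<equiv> concat (map (\<lambda>(a, t). a # t) qs1) @ X @ Y @ T @
         concat (map (\<lambda>(a, t). a # t) qs2) @ X @ p @ Y @ concat (map (\<lambda>(a, t). t @ [a]) rs)"
    and "v \<equiv> concat (map (\<lambda>(a, t). a # t) qs1) @ Y @ X @ T @
         concat (map (\<lambda>(a, t). a # t) qs2) @ X @ p @ Y @ concat (map (\<lambda>(a, t). t @ [a]) rs)"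
  shows "u \<approx> v \<and> rev u \<approx> rev v"
proof -
  define n m k where "n = length qs1" and "m = length qs2" and "k = length rs"
  have len: "length p = n + m + k"
    using mset_eq_length[OF p] by (simp add: n_def m_def k_def)
  let ?q = "map fst qs1 @ map fst qs2 @ map fst rs"
  obtain \<rho> where \<rho>: "\<rho> permutes {1..n+m+k}"
    "\<And>i. 1 \<le> i \<Longrightarrow> i \<le> n+m+k \<Longrightarrow> 1 \<le> \<rho> i \<and> \<rho> i \<le> n+m+k \<and> ?q ! (\<rho> i - 1) = p ! (i - 1)"
    using mset_eq_obtain_permutation[OF p[symmetric]] unfolding len by metis
  define ts where "ts = map snd qs1 @ map snd qs2 @ map snd rs"
  define s where "s a = (case a of
      Lzi i \<Rightarrow> [?q ! (i - 1)] | Lti i \<Rightarrow> ts ! (i - 1) | Lx \<Rightarrow> X | Ly \<Rightarrow> Y | Lt \<Rightarrow> T)" for a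
  have L: "map (\<lambda>i. subst s [Lzi i, Lti i]) [1..<Suc n] = map (\<lambda>(a, t). a # t) qs1"
    by (rule map_nth_upt) (auto simp: s_def ts_def n_def nth_append split: prod.split)
  have C: "map (\<lambda>i. subst s [Lzi i, Lti i]) [n+1..<Suc (n+m)] = map (\<lambda>(a, t). a # t) qs2"
    by (rule map_nth_upt) (auto simp: s_def ts_def n_def m_def nth_append split: prod.split)
  have R: "map (\<lambda>i. subst s [Lti i, Lzi i]) [n+m+1..<Suc (n+m+k)] = map (\<lambda>(a, t). t @ [a]) rs"
    by (rule map_nth_upt)
       (auto simp: s_def ts_def n_def m_def k_def nth_append split: prod.split)
  have M: "map (\<lambda>i. subst s [Lzi (\<rho> i)]) [1..<Suc (n+m+k)] = map (\<lambda>a. [a]) p"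
  proof (rule map_nth_upt)
    fix i assume "i < length p"
    then have i: "1 \<le> Suc i" "Suc i \<le> n + m + k" by (auto simp: len)
    show "subst s [Lzi (\<rho> (1 + i))] = [p ! i]"
      using \<rho>(2)[OF i] by (auto simp: s_def)
  qed (simp add: len)
  have s: "s Lx = X" "s Ly = Y" "s Lt = T" by (simp_all add: s_def)
  have u: "subst s (c_word n m k \<rho>) = u"
    by (simp only: c_word_def u_def subst_simps(3) subst_word_prod L C R M) (simp add: s)
  have v: "subst s (c_word' n m k \<rho>) = v"
    by (simp only: c_word'_def v_def subst_simps(3) subst_word_prod L C R M) (simp add: s)
  have "(c_word n m k \<rho>, c_word' n m k \<rho>) \<in> A'_identities"
    "(rev (c_word n m k \<rho>), rev (c_word' n m k \<rho>)) \<in> A'_identities"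
    using \<rho>(1) unfolding A'_identities_def d_word_def[symmetric] d_word'_def[symmetric] by blast+
  then have "subst s (c_word n m k \<rho>) \<approx> subst s (c_word' n m k \<rho>)"
    "subst (\<lambda>a. rev (s a)) (rev (c_word n m k \<rho>)) \<approx> subst (\<lambda>a. rev (s a)) (rev (c_word' n m k \<rho>))"
    by (simp_all only: substI ax)
  then show ?thesis
    unfolding subst_rev by (simp add: u v)
qed

end

text \<open>The construction marks the last occurrence in \<open>A\<close> of every letter of
  \<open>S\<close>; each \<open>t\<close> is the stretch up to the next marked one. This is the
  shape required by \<open>w_generic\<close> and \<open>c_generic\<close>.\<close>

lemma occurrences_left:
  assumes "S \<subseteq> set A"
  obtains A0 qs where "A = A0 @ concat (map (\<lambda>(a, t). a # t) qs)"
    "distinct (map fst qs)" "set (map fst qs) = S"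
  using assms
proof (induction A arbitrary: S thesis)
  case Nil
  then show ?case by (metis append_Nil concat.simps(1) distinct.simps(1) empty_set list.simps(8) subset_empty)
next
  case (Cons a A)
  show ?case
  proof (cases "S \<subseteq> set A")
    case True
    then obtain A0 qs where "A = A0 @ concat (map (\<lambda>(a, t). a # t) qs)"
      "distinct (map fst qs)" "set (map fst qs) = S" using Cons.IH by blast
    then show ?thesis using Cons.prems(1)[of "a # A0" qs] by simp
  next
    case False
    then have "S - {a} \<subseteq> set A" "a \<in> S" using Cons.prems(2) by auto
    then obtain A0 qs where "A = A0 @ concat (map (\<lambda>(a, t). a # t) qs)"
      "distinct (map fst qs)" "set (map fst qs) = S - {a}" using Cons.IH by blast
    then show ?thesis using Cons.prems(1)[of "[]" "(a, A0) # qs"] \<open>a \<in> S\<close> by auto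
  qed
qed

lemma occurrences_right:
  assumes "S \<subseteq> set A"
  obtains A0 qs where "A = concat (map (\<lambda>(a, t). t @ [a]) qs) @ A0"
    "distinct (map fst qs)" "set (map fst qs) = S"
proof -
  obtain A0 qs where *: "rev A = A0 @ concat (map (\<lambda>(a, t). a # t) qs)"
      "distinct (map fst qs)" "set (map fst qs) = S"
    by (rule occurrences_left[of S "rev A"]) (use assms in auto)
  have "A = concat (map (\<lambda>(a, t). t @ [a]) (rev (map (\<lambda>(a, t). (a, rev t)) qs))) @ rev A0"
    using arg_cong[OF *(1), of rev] by (simp add: rev_concat rev_map comp_def case_prod_beta)
  with * show ?thesis
    by (intro that[of "rev (map (\<lambda>(a, t). (a, rev t)) qs)"])
       (auto simp: rev_map[symmetric] comp_def case_prod_beta)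
qed

context A'_theory begin

text \<open>Every letter of \<open>p\<close> is charged to an occurrence in \<open>A\<close> if
  there is one, and otherwise to one in \<open>B\<close>. In \<open>w_generic\<close> it keeps a
  nonempty value on that side only.\<close>

lemma square_extract:
  assumes "distinct p" "set p \<subseteq> set A \<union> set B"
  shows "A @ X @ p @ X @ B \<approx> A @ X @ X @ p @ B"
proof -
  define L where "L = set p \<inter> set A"
  define R where "R = set p - L"
  obtain A0 qs where A: "A = A0 @ concat (map (\<lambda>(a, t). a # t) qs)"
      "distinct (map fst qs)" "set (map fst qs) = L"
    by (rule occurrences_left[of L A]) (auto simp: L_def)
  obtain B0 rs where B: "B = concat (map (\<lambda>(a, t). t @ [a]) rs) @ B0"
      "distinct (map fst rs)" "set (map fst rs) = R"
    by (rule occurrences_right[of R B]) (use assms in \<open>auto simp: L_def R_def\<close>)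
  define f where "f a = (if a \<in> L then [a] else [])" for a
  define g where "g a = (if a \<in> L then [] else [a])" for a
  \<comment> \<open>Letters charged to the other side are appended with an empty gap. As
    \<open>f\<close> or \<open>g\<close> erases them, they only make the multisets match.\<close>
  define qs' where "qs' = qs @ map (\<lambda>a. (a, [])) (filter (\<lambda>a. a \<notin> L) p)"
  define rs' where "rs' = rs @ map (\<lambda>a. (a, [])) (filter (\<lambda>a. a \<in> L) p)"
  have "mset (map fst qs') = mset p"
    by (subst set_eq_iff_mset_eq_distinct[symmetric])
       (use A assms in \<open>auto simp: qs'_def L_def comp_def\<close>)
  moreover have "mset (map fst rs') = mset p"
    by (subst set_eq_iff_mset_eq_distinct[symmetric])
       (use B assms in \<open>auto simp: rs'_def L_def R_def comp_def\<close>)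
  ultimately have *: "concat (map (\<lambda>(a, t). f a @ t) qs') @ X @ concat (map (\<lambda>a. f a @ g a) p) @ X @
         concat (map (\<lambda>(a, t). t @ g a) rs')
       \<approx> concat (map (\<lambda>(a, t). f a @ t) qs') @ X @ X @ concat (map (\<lambda>a. f a @ g a) p) @
         concat (map (\<lambda>(a, t). t @ g a) rs')"
    by (rule w_generic)
  have 1: "map (\<lambda>(a, t). f a @ t) qs = map (\<lambda>(a, t). a # t) qs"
    using A(3) by (force simp: f_def)
  have 2: "map (\<lambda>(a, t). t @ g a) rs = map (\<lambda>(a, t). t @ [a]) rs"
    using B(3) by (force simp: g_def R_def)
  have 3: "concat (map (f \<circ> fst) (map (\<lambda>a. (a, [])) (filter (\<lambda>a. a \<notin> L) p))) = []"
    "concat (map (g \<circ> fst) (map (\<lambda>a. (a, [])) (filter (\<lambda>a. a \<in> L) p))) = []"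
    by (auto simp: f_def g_def)
  have 4: "f a @ g a = [a]" for a by (simp add: f_def g_def)
  have l: "concat (map (\<lambda>(a, t). f a @ t) qs') = concat (map (\<lambda>(a, t). a # t) qs)"
    unfolding qs'_def by (simp add: 1) (auto simp: f_def)
  have r: "concat (map (\<lambda>(a, t). t @ g a) rs') = concat (map (\<lambda>(a, t). t @ [a]) rs)"
    unfolding rs'_def by (simp add: 2) (auto simp: g_def)
  show ?thesis
    using cong[OF *, of A0 B0] unfolding l r 4 by (simp add: A(1) B(1))
qed

text \<open>The letters of \<open>p\<close> are charged to \<open>A\<close>, \<open>B\<close> or
  \<open>C\<close>, in this order of preference, which gives the three groups of letters in
  \<open>c_generic\<close>. The reversed form serves pairs to the right of the factor that contains
  \<open>p\<close>.\<close>

lemma swap_adjacent: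
  fixes X Y :: word
  assumes "distinct p" "set p \<subseteq> set A \<union> set B \<union> set C"
  defines "u \<equiv> A @ X @ Y @ B @ X @ p @ Y @ C" and "v \<equiv> A @ Y @ X @ B @ X @ p @ Y @ C"
  shows "u \<approx> v" "rev u \<approx> rev v"
proof -
  define SA SB where "SA = set p \<inter> set A" and "SB = (set p - SA) \<inter> set B"
  define SC where "SC = set p - SA - SB"
  obtain A0 qa where A: "A = A0 @ concat (map (\<lambda>(a, t). a # t) qa)"
      "distinct (map fst qa)" "set (map fst qa) = SA"
    by (rule occurrences_left[of SA A]) (auto simp: SA_def)
  obtain B0 qb where B: "B = B0 @ concat (map (\<lambda>(a, t). a # t) qb)"
      "distinct (map fst qb)" "set (map fst qb) = SB"
    by (rule occurrences_left[of SB B]) (auto simp: SB_def)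
  obtain C0 qc where C: "C = concat (map (\<lambda>(a, t). t @ [a]) qc) @ C0"
      "distinct (map fst qc)" "set (map fst qc) = SC"
    by (rule occurrences_right[of SC C]) (use assms in \<open>auto simp: SA_def SB_def SC_def\<close>)
  have "mset (map fst qa @ map fst qb @ map fst qc) = mset p"
    by (subst set_eq_iff_mset_eq_distinct[symmetric])
       (use A(2,3) B(2,3) C(2,3) assms in \<open>auto simp: SA_def SB_def SC_def\<close>)
  from c_generic[OF this, of X Y B0]
  show "u \<approx> v" "rev u \<approx> rev v"
    using cong[of _ _ A0 C0] cong[of _ _ "rev C0" "rev A0"]
    by (fastforce simp: A(1) B(1) C(1) u_def v_def)+
qed

end

section \<open>Squares and simple letters\<close>

definition simple :: "word \<Rightarrow> letter set"
  where "simple w = {a. count_list w a = 1}"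

abbreviation res :: "letter set \<Rightarrow> word \<Rightarrow> word"
  where "res K w \<equiv> filter (\<lambda>a. a \<in> K) w"

lemma count_list_filter: "count_list (filter P w) a = (if P a then count_list w a else 0)"
  by (induction w) auto

lemma in_set_count_list: "a \<in> set w \<longleftrightarrow> 1 \<le> count_list w a"
  using count_list_0_iff[of w a] by linarith

lemma distinct_count_list_le: "distinct w \<Longrightarrow> count_list w a \<le> 1"
  by (induction w) (auto simp: count_list_0_iff)

lemma subst_single:
  "subst (\<lambda>b. if b = a then z else []) w = concat (replicate (count_list w a) z)"
  by (induction w) auto

lemma distinct_res_simple: "distinct (res (simple w) w)"
proof (rule ccontr)
  assume "\<not> distinct (res (simple w) w)"
  then obtain A a B C where eq: "res (simple w) w = A @ [a] @ B @ [a] @ C"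
    by (meson not_distinct_decomp)
  then have "a \<in> set (res (simple w) w)" by simp
  then have "count_list w a = 1" "a \<in> simple w" by (simp_all add: simple_def)
  then have "count_list (res (simple w) w) a = 1" by (simp add: count_list_filter)
  then show False unfolding eq by simp
qed

context A'_theory begin

text \<open>The square is central, so it can travel through \<open>w\<close>, swallow each
  \<open>x\<close> by \<open>cube\<close>, and return to the front.\<close>

lemma square_absorb: "[x, x] @ w \<approx> [x, x] @ filter (\<lambda>a. a \<noteq> x) w"
proof (induction w)
  case Nil
  then show ?case by simp
next
  case (Cons c w)
  show ?case
  proof (cases "c = x")
    case True
    have "[x, x] @ c # w \<approx> [x, x] @ w"
      using sym[OF cong[OF cube[of "[x]"], of "[]" w]] True by simp
    also note Cons.IH
    finally show ?thesis using True by simp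
  next
    case False
    have "[x, x] @ c # w \<approx> [c, x, x] @ w"
      using cong[OF square_commute[of "[x]" "[c]"], of "[]" w] by simp
    also have "\<dots> \<approx> [c, x, x] @ filter (\<lambda>a. a \<noteq> x) w"
      using cong[OF Cons.IH, of "[c]" "[]"] by simp
    also have "\<dots> \<approx> [x, x] @ c # filter (\<lambda>a. a \<noteq> x) w"
      using sym[OF cong[OF square_commute[of "[x]" "[c]"], of "[]"]] by simp
    finally show ?thesis using False by simp
  qed
qed

text \<open>Expresses that \<open>x\<close> acts as a central square in \<open>w\<close>. The square
  is written in front because its position is immaterial; by \<open>squaredI\<close> it suffices
  that some word equivalent to \<open>w\<close> has a factor \<open>[x, x]\<close>.\<close>

definition squared :: "word \<Rightarrow> letter \<Rightarrow> bool"
  where "squared w x \<longleftrightarrow> w \<approx> [x, x] @ filter (\<lambda>a. a \<noteq> x) w"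

lemma squaredI:
  assumes "w \<approx> A @ [x, x] @ B"
  shows "squared w x"
proof -
  have "filter (\<lambda>a. a \<noteq> x) w \<approx> filter (\<lambda>a. a \<noteq> x) (A @ B)"
    using delete[OF assms, of "\<lambda>a. a \<noteq> x"] by simp
  then have *: "[x, x] @ filter (\<lambda>a. a \<noteq> x) (A @ B) \<approx> [x, x] @ filter (\<lambda>a. a \<noteq> x) w"
    using cong[OF sym, of _ _ "[x, x]" "[]"] by simp
  note assms
  also have "A @ [x, x] @ B \<approx> [x, x] @ (A @ B)"
    using sym[OF cong[OF square_commute[of "[x]" A], of "[]" B]] by simp
  also note square_absorb
  also note *
  finally show ?thesis by (simp add: squared_def)
qed

lemma squared_if_squared_twice:
  assumes "squared w y" "squared (filter (\<lambda>a. a \<noteq> y) w) x"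
  shows "squared w x"
proof (rule squaredI)
  have "w \<approx> [y, y] @ filter (\<lambda>a. a \<noteq> y) w"
    using assms(1) by (simp add: squared_def)
  also have "\<dots> \<approx> [y, y] @ [x, x] @ filter (\<lambda>a. a \<noteq> x) (filter (\<lambda>a. a \<noteq> y) w)"
    using cong[of "filter (\<lambda>a. a \<noteq> y) w" _ "[y, y]" "[]"] assms(2) by (simp add: squared_def)
  finally show "w \<approx> [y, y] @ [x, x] @ filter (\<lambda>a. a \<noteq> x) (filter (\<lambda>a. a \<noteq> y) w)" .
qed

text \<open>Induction on the length of \<open>p\<close>. An \<open>x\<close> inside \<open>p\<close>
  gives a shorter gap; another letter repeated in \<open>p\<close> is itself squared and can be
  taken out first. Otherwise every letter of \<open>p\<close> has a further occurrence in
  \<open>A\<close> or \<open>B\<close>, and \<open>square_extract\<close> applies.\<close>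

lemma squared_twice_in_block:
  assumes "w = A @ [x] @ p @ [x] @ B" "\<And>a. a \<in> set p \<Longrightarrow> 2 \<le> count_list w a"
  shows "squared w x"
  using assms
proof (induction "length p" arbitrary: w A p B x rule: less_induct)
  case less
  note w = less.prems(1)
  consider (x) "x \<in> set p" | (rep) "x \<notin> set p" "\<not> distinct p" | (dist) "x \<notin> set p" "distinct p"
    by blast
  then show ?case
  proof cases
    case x
    then obtain p1 p2 where "p = p1 @ x # p2" by (meson split_list)
    then show ?thesis
      using less.prems by (intro less.hyps[of p1 w A x "p2 @ [x] @ B"]) auto
  next
    case rep
    then obtain p1 y p2 p3 where p: "p = p1 @ [y] @ p2 @ [y] @ p3"
      by (meson not_distinct_decomp)
    have "squared w y"
      using less.prems p by (intro less.hyps[of p2 w "A @ [x] @ p1" y "p3 @ [x] @ B"]) auto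
    moreover have "squared (filter (\<lambda>a. a \<noteq> y) w) x"
    proof (rule less.hyps)
      have "x \<noteq> y" using rep p by auto
      then show "filter (\<lambda>a. a \<noteq> y) w =
        filter (\<lambda>a. a \<noteq> y) A @ [x] @ filter (\<lambda>a. a \<noteq> y) p @ [x] @ filter (\<lambda>a. a \<noteq> y) B"
        using w by simp
      show "length (filter (\<lambda>a. a \<noteq> y) p) < length p"
        by (rule length_filter_less[of y]) (auto simp: p)
      show "2 \<le> count_list (filter (\<lambda>a. a \<noteq> y) w) a" if "a \<in> set (filter (\<lambda>a. a \<noteq> y) p)" for a
        using that less.prems(2)[of a] by (simp add: count_list_filter)
    qed
    ultimately show ?thesis by (rule squared_if_squared_twice)
  next
    case dist
    have "set p \<subseteq> set A \<union> set B"
    proof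
      fix a assume "a \<in> set p"
      then have "2 \<le> count_list w a" "count_list p a \<le> 1" "a \<noteq> x"
        using less.prems(2) dist distinct_count_list_le by auto
      then show "a \<in> set A \<union> set B"
        using w count_list_0_iff[of A a] count_list_0_iff[of B a] by fastforce
    qed
    from square_extract[OF dist(2) this, of "[x]"] show ?thesis
      using w by (intro squaredI[of _ A _ "p @ B"]) simp
  qed
qed

definition commut :: bool
  where "commut \<longleftrightarrow> [Lx, Ly] \<approx> [Ly, Lx]"

lemma commutD: "commut \<Longrightarrow> u @ v \<approx> v @ u"
  using substI[of "[Lx, Ly]" "[Ly, Lx]" "\<lambda>a. if a = Lx then u else v"] by (simp add: commut_def)

lemma commutI:
  assumes "[a, b] \<approx> [b, a]" "a \<noteq> b"
  shows commut
  using substI[OF assms(1), of "\<lambda>c. if c = a then [Lx] else [Ly]"] assms(2) by (simp add: commut_def)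

lemma totalD:
  assumes "[] \<approx> [Lx]"
  shows "u \<approx> v"
proof -
  have "[] \<approx> w" for w
    using substI[OF assms, of "\<lambda>_. w"] by simp
  then show ?thesis using trans sym by metis
qed

text \<open>Squares are central, and here every letter equals its square.\<close>

lemma idem_imp_commut:
  assumes "[Lx] \<approx> [Lx, Lx]"
  shows commut
proof -
  have "[Lx] @ [Ly] \<approx> [Lx, Lx] @ [Ly]"
    using cong[OF assms, of "[]"] by simp
  also have "\<dots> \<approx> [Ly] @ [Lx, Lx]"
    using square_commute[of "[Lx]" "[Ly]"] by simp
  also have "\<dots> \<approx> [Ly] @ [Lx]"
    using sym[OF cong[OF assms, of "[Ly]" "[]"]] by simp
  finally show ?thesis by (simp add: commut_def)
qed

lemma replicate_square: "2 \<le> k \<Longrightarrow> replicate k x \<approx> [x, x]"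
proof (induction k rule: dec_induct)
  case base
  then show ?case by (simp add: numeral_2_eq_2)
next
  case (step k)
  have "replicate (Suc k) x \<approx> [x] @ [x, x]"
    using cong[OF step(3), of "[x]" "[]"] by simp
  also have "\<dots> \<approx> [x, x]"
    using sym[OF cube[of "[x]"]] by simp
  finally show ?case .
qed

text \<open>Erasing all letters but one that occurs in only one of the words makes a power of
  \<open>x\<close> with exponent \<open>k\<close> at least 1 trivial. Then \<open>x\<close> is
  equivalent to its power \<open>2 * k + 1\<close>, hence to its square, to its power
  \<open>2 * k\<close>, and to the empty word.\<close>

lemma content_eq:
  assumes "\<not> [] \<approx> [Lx]" "u \<approx> v"
  shows "set u = set v"
proof -
  have False if "u \<approx> v" "a \<in> set u" "a \<notin> set v" for u v a
  proof -
    define k where "k = count_list u a"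
    have k: "1 \<le> k" using that(2) by (simp add: k_def in_set_count_list)
    have rep: "concat (replicate m [Lx]) = replicate m Lx" for m
      by (induction m) auto
    have "count_list v a = 0" using that(3) by (simp add: count_list_0_iff)
    then have 1: "replicate k Lx \<approx> []"
      using substI[OF that(1), of "\<lambda>b. if b = a then [Lx] else []"]
      by (simp add: subst_single rep k_def)
    have "[Lx] \<approx> [Lx] @ replicate k Lx @ replicate k Lx"
      using cong[OF cong_append[OF sym[OF 1] sym[OF 1]], of "[Lx]" "[]"] by simp
    also have "\<dots> = replicate (Suc (k + k)) Lx"
      by (simp add: replicate_add)
    also have "\<dots> \<approx> [Lx, Lx]"
      using k by (intro replicate_square) auto
    also have "\<dots> \<approx> replicate (k + k) Lx"
      using k by (intro sym[OF replicate_square]) auto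
    also have "\<dots> \<approx> []"
      using cong_append[OF 1 1] by (simp add: replicate_add)
    finally show False using assms(1) sym[of "[Lx]" "[]"] by simp
  qed
  from this[OF assms(2)] this[OF sym[OF assms(2)]] show ?thesis by blast
qed

text \<open>Erasing all letters but one that is simple in only one of the words leaves
  \<open>x\<close> on one side and, by \<open>content_eq\<close>, a power with exponent at least 2
  on the other, which equals the square.\<close>

lemma simple_eq:
  assumes "\<not> [Lx] \<approx> [Lx, Lx]" "u \<approx> v"
  shows "simple u = simple v"
proof -
  have nt: "\<not> [] \<approx> [Lx]" using assms(1) totalD by blast
  have False if "u \<approx> v" "count_list u a = 1" "count_list v a \<noteq> 1" for u v a
  proof -
    have rep: "concat (replicate m [Lx]) = replicate m Lx" for m
      by (induction m) auto
    have "a \<in> set v"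
      using content_eq[OF nt that(1)] that(2) by (metis in_set_count_list order_refl)
    then have "2 \<le> count_list v a"
      using that(3) by (simp add: in_set_count_list)
    moreover have "[Lx] \<approx> replicate (count_list v a) Lx"
      using substI[OF that(1), of "\<lambda>b. if b = a then [Lx] else []"] that(2)
      by (simp add: subst_single rep)
    ultimately show False
      using trans[OF _ replicate_square] assms(1) by metis
  qed
  from this[OF assms(2)] this[OF sym[OF assms(2)]] show ?thesis unfolding simple_def by blast
qed

end

text \<open>The pair consists of the letters at the first place where the lists differ.\<close>

lemma distinct_lists_differ:
  assumes "distinct u" "distinct v" "set u = set v" "u \<noteq> v"
  obtains a b where "a \<noteq> b" "res {a, b} u = [a, b]" "res {a, b} v = [b, a]"
  using assms
proof (induction u arbitrary: v thesis)
  case Nil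
  then show ?case by simp
next
  case (Cons c u)
  obtain d v' where v: "v = d # v'"
    using Cons.prems by (cases v) auto
  show ?case
  proof (cases "c = d")
    case True
    then have *: "distinct v'" "u \<noteq> v'" "distinct u" "c \<notin> set u" "c \<notin> set v'"
      using Cons.prems v by auto
    then have "set u = set v'"
      using insert_ident[of c "set u" "set v'"] Cons.prems v True by auto
    with * obtain a b where ab: "a \<noteq> b" "res {a, b} u = [a, b]" "res {a, b} v' = [b, a]"
      using Cons.IH by blast
    then have "{a, b} \<subseteq> set u"
      by (metis empty_set filter_is_subset list.simps(15))
    then have "c \<noteq> a" "c \<noteq> b" using \<open>c \<notin> set u\<close> by auto
    then show ?thesis using ab v True by (intro Cons.prems(1)[of a b]) auto
  next
    case False
    have "d \<in> set (c # u)" "c \<in> set v"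
      by (simp only: Cons.prems(4) v list.set_intros, simp only: Cons.prems(4)[symmetric] list.set_intros)
    then have du: "d \<in> set u" and cv: "c \<in> set v'"
      using False v by simp_all
    have single: "res {a, b} w = [b]" if "distinct w" "b \<in> set w" "a \<notin> set w" for a b :: letter and w
      using that
    proof (induction w)
      case (Cons e w)
      then show ?case by (cases "e = b") (auto simp: filter_empty_conv)
    qed simp
    have "res {c, d} u = [d]" using Cons.prems du by (intro single) auto
    moreover have "res {c, d} v' = [c]"
      using single[of v' c d] Cons.prems cv v by (auto simp: insert_commute)
    ultimately show ?thesis
      using False v by (intro Cons.prems(1)[of c d]) auto
  qed
qed

context A'_theory begin

text \<open>Two simple letters in opposite order would give commutativity once all other letters are
  deleted.\<close>

lemma simple_order_eq:
  assumes "\<not> commut" "u \<approx> v"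
  shows "res (simple u) u = res (simple v) v"
proof (rule ccontr)
  assume ne: "res (simple u) u \<noteq> res (simple v) v"
  have "\<not> [Lx] \<approx> [Lx, Lx]" using assms(1) idem_imp_commut by blast
  then have s: "simple u = simple v" by (rule simple_eq) fact
  have sub: "simple w \<subseteq> set w" for w
    by (auto simp: simple_def in_set_count_list)
  then have "set (res (simple u) u) = set (res (simple v) v)"
    using s by auto
  then obtain a b where ab: "a \<noteq> b" "res {a, b} (res (simple u) u) = [a, b]"
    "res {a, b} (res (simple v) v) = [b, a]"
    using distinct_lists_differ[OF distinct_res_simple distinct_res_simple _ ne] by blast
  have "[a, b] \<approx> [b, a]"
    using delete[OF delete[OF assms(2)], of "\<lambda>c. c \<in> {a, b}" "\<lambda>c. c \<in> simple u"] ab s by simp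
  then show False using commutI ab(1) assms(1) by blast
qed

lemma commut_mset:
  assumes commut
  shows "mset u = mset v \<Longrightarrow> u \<approx> v"
proof (induction u arbitrary: v)
  case Nil
  then show ?case by simp
next
  case (Cons a u)
  then have "a \<in> set v" by (metis list.set_intros(1) mset_eq_setD)
  then obtain v1 v2 where v: "v = v1 @ a # v2" by (meson split_list)
  have "[a] @ u \<approx> [a] @ v1 @ v2"
    using cong[OF Cons.IH[of "v1 @ v2"], of "[a]" "[]"] Cons.prems v by simp
  also have "\<dots> \<approx> v"
    using cong[OF commutD[OF assms, of "[a]" v1], of "[]" v2] v by simp
  finally show ?case by simp
qed

end

section \<open>Alternating words, and thinning out the letters that separate occurrences\<close>

definition alt :: "letter \<Rightarrow> word \<Rightarrow> word"
  where "alt x ts = x # concat (map (\<lambda>t. [t, x]) ts)"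

lemma alt_simps [simp]: "alt x [] = [x]" "alt x (t # ts) = x # t # alt x ts"
  by (simp_all add: alt_def)

lemma alt_append: "alt x (ts @ t # us) = alt x ts @ t # alt x us"
  by (induction ts) auto

lemma count_list_alt: "x \<notin> set ts \<Longrightarrow> count_list (alt x ts) x = Suc (length ts)"
  by (induction ts) auto

lemma filter_alt: "x \<notin> set ts \<Longrightarrow> filter (\<lambda>a. a \<noteq> x) (alt x ts) = ts"
  by (induction ts) auto

lemma set_alt: "set (alt x ts) = insert x (set ts)"
  by (induction ts) auto

text \<open>For a word restricted to its simple letters and a set \<open>M\<close> of multiple
  letters, this says that no block of the original word contains two occurrences of letters of
  \<open>M\<close>.\<close>

abbreviation nonadj :: "letter set \<Rightarrow> word \<Rightarrow> bool"
  where "nonadj M w \<equiv> successively (\<lambda>c d. c \<notin> M \<or> d \<notin> M) w"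

lemma not_nonadj_split:
  assumes "\<not> nonadj M w"
  obtains A c d B where "w = A @ [c, d] @ B" "c \<in> M" "d \<in> M"
  using assms
proof (induction w arbitrary: thesis)
  case (Cons c w)
  show ?case
  proof (cases "nonadj M w")
    case True
    then show ?thesis
      using Cons.prems(2) by (cases w) (auto intro: Cons.prems(1)[of "[]"])
  next
    case False
    then obtain A c' d B where "w = A @ [c', d] @ B" "c' \<in> M" "d \<in> M"
      using Cons.IH by blast
    then show ?thesis by (intro Cons.prems(1)[of "c # A" c' d B]) auto
  qed
qed simp

lemma nonadj_count_le: "nonadj {x} w \<Longrightarrow> count_list w x \<le> Suc (length (filter (\<lambda>a. a \<noteq> x) w))"
proof (induction w rule: induct_list012)
  case (3 a b w)
  then show ?case by (cases "a = x"; cases "b = x") (auto simp: successively_Cons)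
qed auto

text \<open>The count attains the bound of \<open>nonadj_count_le\<close>, so \<open>x\<close> fills
  all places before, between and after the letters of \<open>ts\<close>.\<close>

lemma alt_unique:
  assumes "nonadj {x} w" "filter (\<lambda>a. a \<noteq> x) w = ts" "Suc (length ts) \<le> count_list w x"
  shows "w = alt x ts"
  using assms
proof (induction ts arbitrary: w)
  case Nil
  have "w \<noteq> []" using Nil.prems(3) by auto
  then obtain c w' where w: "w = c # w'" by (cases w) auto
  have "c = x" using Nil.prems(2) w by (auto split: if_splits)
  then show ?case
    using Nil.prems w by (cases w') (auto split: if_splits)
next
  case (Cons t ts)
  have w: "w \<noteq> []" using Cons.prems by auto
  show ?case
  proof (cases "hd w = x")
    case True
    then obtain w' where w': "w = x # w'" using w by (cases w) auto
    then obtain c w'' where w'': "w' = c # w''" "c \<noteq> x"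
      using Cons.prems by (cases w') auto
    have "c = t" "t \<noteq> x"
      using Cons.prems(2) w' w'' by auto
    have "nonadj {x} w''"
      using Cons.prems(1) by (simp add: w' w'' successively_Cons) (cases w''; simp)
    then show ?thesis
      using Cons.prems Cons.IH[of w''] \<open>c = t\<close> \<open>t \<noteq> x\<close> by (simp add: w' w'')
  next
    case False
    then obtain w' where w': "w = t # w'" "t \<noteq> x" using w Cons.prems(2) by (cases w) auto
    then have "nonadj {x} w'" using Cons.prems(1) by (cases w') auto
    \<comment> \<open>A word starting with \<open>t\<close> has room for only
      \<open>Suc (length ts)\<close> separated occurrences of \<open>x\<close>, one too few.\<close>
    then show ?thesis
      using nonadj_count_le[of x w'] Cons.prems w' by auto
  qed
qed

text \<open>One letter is kept from every gap between consecutive occurrences of letters of \<open>M\<close>.\<close>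

lemma thin_gaps:
  assumes "nonadj M w" "distinct (filter (\<lambda>a. a \<notin> M) w)" "set w \<inter> M \<noteq> {}"
  obtains m ps where "res (M \<union> set (map fst ps)) w = m # concat (map (\<lambda>(t, c). [t, c]) ps)"
    "set (map fst ps) \<subseteq> set w - M" "set (map snd ps) \<subseteq> M" "m \<in> M" "distinct (map fst ps)"
  using assms
proof (induction "length w" arbitrary: w thesis rule: less_induct)
  case less
  obtain c w' where w: "w = c # w'" using less.prems(4) by (cases w) auto
  have adj: "nonadj M w'" using less.prems(2) w by (cases w') auto
  show ?case
  proof (cases "c \<in> M")
    case False
    have "distinct (filter (\<lambda>a. a \<notin> M) w')" "set w' \<inter> M \<noteq> {}" "c \<notin> set w'"
      using less.prems w False by auto
    then obtain m ps where *: "res (M \<union> set (map fst ps)) w' = m # concat (map (\<lambda>(t, c). [t, c]) ps)"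
      "set (map fst ps) \<subseteq> set w' - M" "set (map snd ps) \<subseteq> M" "m \<in> M" "distinct (map fst ps)"
      using less.hyps[of w'] adj w by auto
    then have "c \<notin> M \<union> set (map fst ps)" using False \<open>c \<notin> set w'\<close> by auto
    then show ?thesis using * w by (intro less.prems(1)[of ps m]) auto
  next
    case True
    show ?thesis
    proof (cases "set w' \<inter> M = {}")
      case empty: True
      then have "res M w' = []" by (auto simp: filter_empty_conv)
      then show ?thesis using w True by (intro less.prems(1)[of "[]" c]) auto
    next
      case False
      then obtain t w'' where w': "w' = t # w''" by (cases w') auto
      have t: "t \<notin> M" using less.prems(2) w w' True by auto
      have "nonadj M w''" using adj w' by (cases w'') auto
      moreover have "distinct (filter (\<lambda>a. a \<notin> M) w'')" "set w'' \<inter> M \<noteq> {}" "t \<notin> set w''"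
        using less.prems w w' False t True by auto
      ultimately obtain m ps where *:
        "res (M \<union> set (map fst ps)) w'' = m # concat (map (\<lambda>(t, c). [t, c]) ps)"
        "set (map fst ps) \<subseteq> set w'' - M" "set (map snd ps) \<subseteq> M" "m \<in> M" "distinct (map fst ps)"
        using less.hyps[of w''] w w' by auto
      have "res (M \<union> set (map fst ((t, m) # ps))) w'' = res (M \<union> set (map fst ps)) w''"
        using \<open>t \<notin> set w''\<close> by (intro filter_cong) auto
      then show ?thesis
        using * w w' True \<open>t \<notin> set w''\<close> t by (intro less.prems(1)[of "(t, m) # ps" c]) auto
    qed
  qed
qed

lemma thin_gaps_single:
  assumes "nonadj {x} w" "distinct (filter (\<lambda>a. a \<noteq> x) w)" "x \<in> set w"
  obtains ts where "res (insert x (set ts)) w = alt x ts" "set ts \<subseteq> set w - {x}" "distinct ts"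
proof -
  obtain m ps where ps: "res ({x} \<union> set (map fst ps)) w = m # concat (map (\<lambda>(t, c). [t, c]) ps)"
    "set (map fst ps) \<subseteq> set w - {x}" "set (map snd ps) \<subseteq> {x}" "m \<in> {x}" "distinct (map fst ps)"
    by (rule thin_gaps[of "{x}" w]) (use assms in auto)
  have "m # concat (map (\<lambda>(t, c). [t, c]) qs) = alt x (map fst qs)" if "set (map snd qs) \<subseteq> {x}" for qs
    using that ps(4) by (induction qs) (auto simp: alt_def)
  then show ?thesis using ps by (intro that[of "map fst ps"]) auto
qed

text \<open>At the first difference one word has \<open>x\<close> and the other has
  \<open>t\<close>; in the former, at least one more \<open>x\<close> precedes the corresponding
  \<open>t\<close>.\<close>

lemma differ_at_split:
  assumes "filter (\<lambda>a. a \<noteq> x) u = filter (\<lambda>a. a \<noteq> x) v" "count_list u x = count_list v x" "u \<noteq> v"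
  obtains A t B A' B' where "u = A @ t # B" "v = A' @ t # B'" "t \<noteq> x"
    "count_list A x \<noteq> count_list A' x"
  using assms
proof (induction u arbitrary: v thesis)
  case Nil
  then have "v = []" by (cases v) (auto split: if_splits)
  then show ?case using Nil by simp
next
  case (Cons c u)
  have *: "\<exists>A B. w = A @ t # B \<and> 1 \<le> count_list A x"
    if "filter (\<lambda>a. a \<noteq> x) w = t # ts" "w = x # w'" "t \<noteq> x" for w w' t ts
  proof -
    have "t \<in> set (filter (\<lambda>a. a \<noteq> x) w')" using that by simp
    then have "t \<in> set w'" by simp
    then obtain A B where "w' = A @ t # B" by (meson split_list)
    then show ?thesis using that(2) by (intro exI[of _ "x # A"] exI[of _ B]) simp
  qed
  show ?case
  proof (cases v)
    case Nil
    then show ?thesis using Cons.prems by (auto split: if_splits)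
  next
    case v: (Cons d v')
    show ?thesis
    proof (cases "c = d")
      case True
      then have "filter (\<lambda>a. a \<noteq> x) u = filter (\<lambda>a. a \<noteq> x) v'" "count_list u x = count_list v' x" "u \<noteq> v'"
        using Cons.prems v by (auto split: if_splits)
      then obtain A t B A' B' where "u = A @ t # B" "v' = A' @ t # B'" "t \<noteq> x"
        "count_list A x \<noteq> count_list A' x"
        using Cons.IH by blast
      then show ?thesis
        using v True by (intro Cons.prems(1)[of "c # A" t B "c # A'" B']) auto
    next
      case False
      show ?thesis
      proof (cases "c = x")
        case True
        then obtain A B where "c # u = A @ d # B" "1 \<le> count_list A x"
          using *[of "c # u" d "filter (\<lambda>a. a \<noteq> x) v'" u] Cons.prems v False by auto
        then show ?thesis
          using v True False by (intro Cons.prems(1)[of A d B "[]" v']) auto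
      next
        case c: False
        then have "d = x" using Cons.prems(2) v False by (auto split: if_splits)
        then obtain A B where "v = A @ c # B" "1 \<le> count_list A x"
          using *[of v c "filter (\<lambda>a. a \<noteq> x) u" v'] Cons.prems v c by auto
        then show ?thesis
          using c by (intro Cons.prems(1)[of "[]" c u A B]) auto
      qed
    qed
  qed
qed

section \<open>Identities between words with one multiple letter\<close>

lemma prefix_before_unique:
  assumes "A @ t # B = A' @ t # B'" "t \<notin> set A" "t \<notin> set A'"
  shows "A = A'"
proof -
  have "takeWhile (\<lambda>a. a \<noteq> t) (A @ t # B) = A" "takeWhile (\<lambda>a. a \<noteq> t) (A' @ t # B') = A'"
    using assms(2,3) by (auto simp: takeWhile_append)
  then show ?thesis using assms(1) by simp
qed

context A'_theory begin

text \<open>Deleting all letters except \<open>x\<close> and \<open>ts\<close> turns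
  \<open>u\<close> into the alternating word, while a factor \<open>[x, x]\<close> in the shortened
  \<open>v\<close> makes \<open>x\<close> a square there.\<close>

lemma alt_square_if_adjacent:
  assumes uv: "u \<approx> v" and eq: "filter (\<lambda>a. a \<noteq> x) u = filter (\<lambda>a. a \<noteq> x) v"
    and thin: "res (insert x (set ts)) u = alt x ts" "x \<notin> set ts"
    and adj: "\<not> nonadj {x} (res (insert x (set ts)) v)"
  shows "alt x ts \<approx> [x, x] @ ts"
proof -
  let ?D = "insert x (set ts)"
  obtain A B where "res ?D v = A @ [x, x] @ B"
    using not_nonadj_split[OF adj] by blast
  then have "squared (res ?D v) x" by (intro squaredI[of _ A x B]) simp
  moreover have "filter (\<lambda>a. a \<noteq> x) (res ?D v) = filter (\<lambda>a. a \<noteq> x) (res ?D u)"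
    using arg_cong[OF eq, of "res ?D"] by (simp add: conj_commute)
  ultimately have "res ?D v \<approx> [x, x] @ ts"
    unfolding squared_def thin(1) filter_alt[OF thin(2)] by simp
  moreover have "alt x ts \<approx> res ?D v"
    using delete[OF uv, of "\<lambda>a. a \<in> ?D"] unfolding thin(1) .
  ultimately show ?thesis using trans by blast
qed

text \<open>
  If one word distributes the occurrences of \<open>x\<close> differently over the gaps between the simple
  letters, then cutting down to suitable simple letters makes one side square.
\<close>

lemma alt_square_if_split:
  assumes uv: "u \<approx> v" and eq: "filter (\<lambda>a. a \<noteq> x) u = filter (\<lambda>a. a \<noteq> x) v"
    and dist: "distinct (filter (\<lambda>a. a \<noteq> x) u)"
    and adj: "nonadj {x} u" and cnt: "count_list u x = count_list v x"
    and split: "u = A @ t # B" "v = A' @ t # B'" "t \<noteq> x" "count_list A x \<noteq> count_list A' x"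
    and A: "x \<in> set A" and B: "x \<in> set B"
  obtains ts where "distinct (x # ts)" "Suc (length ts) = count_list u x" "alt x ts \<approx> [x, x] @ ts"
proof -
  have "nonadj {x} A" "nonadj {x} B"
    using adj unfolding split(1) by (auto simp: successively_append_iff successively_Cons)
  moreover have "distinct (filter (\<lambda>a. a \<noteq> x) A)" "distinct (filter (\<lambda>a. a \<noteq> x) B)"
    using dist unfolding split(1) by (auto simp: split(3))
  ultimately obtain ts1 ts2 where
    ts1: "res (insert x (set ts1)) A = alt x ts1" "set ts1 \<subseteq> set A - {x}" "distinct ts1" and
    ts2: "res (insert x (set ts2)) B = alt x ts2" "set ts2 \<subseteq> set B - {x}" "distinct ts2"
    using thin_gaps_single[of x A] thin_gaps_single[of x B] A B by metis
  define ts where "ts = ts1 @ t # ts2"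
  have disj: "set A \<inter> set B \<subseteq> {x}" "t \<notin> set A" "t \<notin> set B"
    using dist unfolding split(1) by (auto simp: split(3))
  have ts: "distinct (x # ts)"
    using ts1 ts2 disj split(3) by (auto simp: ts_def)
  have "res (insert x (set ts)) A = res (insert x (set ts1)) A"
    using disj ts2(2) by (intro filter_cong) (auto simp: ts_def)
  moreover have "res (insert x (set ts)) B = res (insert x (set ts2)) B"
    using disj ts1(2) by (intro filter_cong) (auto simp: ts_def)
  ultimately have thin: "res (insert x (set ts)) u = alt x ts"
    using ts1(1) ts2(1) by (simp add: split(1) ts_def alt_append)
  have len: "Suc (length ts) = count_list u x"
    using arg_cong[OF thin, of "\<lambda>w. count_list w x"] ts by (simp add: count_list_filter count_list_alt)
  \<comment> \<open>Otherwise \<open>alt_unique\<close> would identify the shortened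
    \<open>v\<close> with \<open>alt x ts\<close>, and equally many \<open>x\<close> would precede
    \<open>t\<close> in both words.\<close>
  have "\<not> nonadj {x} (res (insert x (set ts)) v)"
  proof
    let ?v = "res (insert x (set ts)) v"
    assume "nonadj {x} ?v"
    moreover have "filter (\<lambda>a. a \<noteq> x) ?v = filter (\<lambda>a. a \<noteq> x) (res (insert x (set ts)) u)"
      using arg_cong[OF eq, of "res (insert x (set ts))"] by (simp add: conj_commute)
    then have "filter (\<lambda>a. a \<noteq> x) ?v = ts"
      using ts by (simp only: thin filter_alt[of x ts] distinct.simps not_False_eq_True)
    moreover have "count_list ?v x = Suc (length ts)"
      using cnt len by (simp add: count_list_filter)
    ultimately have "?v = alt x ts" by (intro alt_unique) auto
    then have "res (insert x (set ts)) A' @ t # res (insert x (set ts)) B' = alt x ts1 @ t # alt x ts2"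
      by (simp add: split(2) ts_def alt_append)
    moreover have "t \<notin> set (res (insert x (set ts)) A')" "t \<notin> set (alt x ts1)"
    proof -
      have "distinct (filter (\<lambda>a. a \<noteq> x) v)" using dist eq by simp
      then show "t \<notin> set (res (insert x (set ts)) A')"
        unfolding split(2) by (auto simp: split(3))
      show "t \<notin> set (alt x ts1)"
        using ts by (auto simp: ts_def set_alt)
    qed
    ultimately have "res (insert x (set ts)) A' = alt x ts1"
      by (rule prefix_before_unique)
    then have "res (insert x (set ts)) A' = res (insert x (set ts)) A"
      using ts1(1) \<open>res (insert x (set ts)) A = _\<close> by simp
    from arg_cong[OF this, of "\<lambda>w. count_list w x"] show False
      using split(4) by (simp add: count_list_filter)
  qed
  from alt_square_if_adjacent[OF uv eq thin _ this] ts len show ?thesis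
    by (intro that[of ts]) auto
qed

text \<open>In \<open>u\<close> all \<open>x\<close> follow \<open>t\<close>, in \<open>v\<close>
  all precede it. The separators are taken from \<open>B\<close>; since the same letters other than
  \<open>x\<close> precede \<open>t\<close> in both words, none of them lies in \<open>A'\<close>,
  so the \<open>x\<close> of \<open>v\<close> become adjacent.\<close>

lemma alt_square_if_outside:
  assumes uv: "u \<approx> v" and eq: "filter (\<lambda>a. a \<noteq> x) u = filter (\<lambda>a. a \<noteq> x) v"
    and dist: "distinct (filter (\<lambda>a. a \<noteq> x) u)"
    and adj: "nonadj {x} u" and cnt: "2 \<le> count_list u x" "count_list u x = count_list v x"
    and split: "u = A @ t # B" "v = A' @ t # B'" "t \<noteq> x"
    and "x \<notin> set A" "x \<notin> set B'"
  obtains ts where "distinct (x # ts)" "Suc (length ts) = count_list u x" "alt x ts \<approx> [x, x] @ ts"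
proof -
  have "nonadj {x} B"
    using adj unfolding split(1) by (auto simp: successively_append_iff successively_Cons)
  moreover have "distinct (filter (\<lambda>a. a \<noteq> x) B)"
    using dist unfolding split(1) by (auto simp: split(3))
  moreover have "x \<in> set B"
    using cnt(1) split assms(10) count_list_0_iff[of A x] count_list_0_iff[of B x] by auto
  ultimately obtain ts where
    ts: "res (insert x (set ts)) B = alt x ts" "set ts \<subseteq> set B - {x}" "distinct ts"
    using thin_gaps_single[of x B] by metis
  have disj: "set A \<inter> set B \<subseteq> {x}" "t \<notin> set A" "t \<notin> set B"
    using dist unfolding split(1) by (auto simp: split(3))
  have "res (insert x (set ts)) A = []"
    using disj ts(2) assms(10) by (auto simp: filter_empty_conv)
  then have thin: "res (insert x (set ts)) u = alt x ts"
    using ts split(3) disj by (auto simp: split(1))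
  have dx: "distinct (x # ts)" using ts by auto
  have len: "Suc (length ts) = count_list u x"
    using arg_cong[OF thin, of "\<lambda>w. count_list w x"] dx by (simp add: count_list_filter count_list_alt)
  have "filter (\<lambda>a. a \<noteq> x) A @ t # filter (\<lambda>a. a \<noteq> x) B
      = filter (\<lambda>a. a \<noteq> x) A' @ t # filter (\<lambda>a. a \<noteq> x) B'"
    using eq split by simp
  moreover have "t \<notin> set (filter (\<lambda>a. a \<noteq> x) A)" "t \<notin> set (filter (\<lambda>a. a \<noteq> x) A')"
  proof -
    have "distinct (filter (\<lambda>a. a \<noteq> x) v)" using dist eq by simp
    then show "t \<notin> set (filter (\<lambda>a. a \<noteq> x) A')"
      unfolding split(2) by (auto simp: split(3))
  qed (use disj in auto)
  ultimately have "filter (\<lambda>a. a \<noteq> x) A = filter (\<lambda>a. a \<noteq> x) A'"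
    by (rule prefix_before_unique)
  then have "set (filter (\<lambda>a. a \<noteq> x) A') = set (filter (\<lambda>a. a \<noteq> x) A)" by simp
  then have "set A' \<subseteq> insert x (set A)" by auto
  then have "set (res (insert x (set ts)) A') \<subseteq> {x}"
    using disj ts(2) by auto
  then have "res (insert x (set ts)) A' = replicate (count_list A' x) x"
  proof -
    assume "set (res (insert x (set ts)) A') \<subseteq> {x}"
    then have "replicate (length (res (insert x (set ts)) A')) x = res (insert x (set ts)) A'"
      by (intro replicate_length_same) auto
    moreover have "count_list (replicate n x) x = n" for n by (induction n) auto
    ultimately show ?thesis by (metis count_list_filter insertI1)
  qed
  moreover have "2 \<le> count_list A' x"
    using cnt split(2,3) assms(11) by (auto simp: count_list_0_iff)
  then obtain k where "count_list A' x = Suc (Suc k)"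
    by (metis Suc_le_D add_2_eq_Suc le_Suc_ex)
  ultimately have "\<not> nonadj {x} (res (insert x (set ts)) v)"
    by (simp add: split(2))
  from alt_square_if_adjacent[OF uv eq thin _ this] dx len show ?thesis
    by (intro that[of ts]) auto
qed

text \<open>If \<open>v\<close> has more occurrences of \<open>x\<close> than \<open>u\<close>, or
  adjacent ones, then after thinning \<open>u\<close> the shortened \<open>v\<close> has an adjacent
  pair, in the former case by counting. Otherwise a letter \<open>t\<close> splits the occurrences
  differently: either some word has \<open>x\<close> on both sides of \<open>t\<close>, or the two
  words have all their \<open>x\<close> on opposite sides.\<close>

lemma alt_square_if_differ:
  assumes uv: "u \<approx> v" and eq: "filter (\<lambda>a. a \<noteq> x) u = filter (\<lambda>a. a \<noteq> x) v"
    and dist: "distinct (filter (\<lambda>a. a \<noteq> x) u)"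
    and adj: "nonadj {x} u" and ne: "u \<noteq> v"
    and cnt: "2 \<le> count_list u x" "nonadj {x} v \<Longrightarrow> count_list u x \<le> count_list v x"
  obtains ts where "distinct (x # ts)" "Suc (length ts) = count_list u x" "alt x ts \<approx> [x, x] @ ts"
proof (cases "nonadj {x} v \<and> count_list u x = count_list v x")
  case False
  have "x \<in> set u" using cnt(1) count_list_0_iff[of u x] by auto
  then obtain ts where ts: "res (insert x (set ts)) u = alt x ts" "set ts \<subseteq> set u - {x}" "distinct ts"
    using thin_gaps_single[OF adj dist] by blast
  have len: "Suc (length ts) = count_list u x"
    using arg_cong[OF ts(1), of "\<lambda>w. count_list w x"] ts(2)
    by (subst (asm) count_list_alt) (auto simp: count_list_filter)
  let ?v = "res (insert x (set ts)) v"
  have "filter (\<lambda>a. a \<noteq> x) ?v = filter (\<lambda>a. a \<noteq> x) (res (insert x (set ts)) u)"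
    using arg_cong[OF eq, of "res (insert x (set ts))"] by (simp add: conj_commute)
  then have filt: "filter (\<lambda>a. a \<noteq> x) ?v = ts"
    using ts by (subst (asm) ts(1), subst (asm) filter_alt) auto
  have "\<not> nonadj {x} ?v"
  proof (cases "nonadj {x} v")
    case True
    then have "count_list u x < count_list v x" using False cnt(2) by simp
    then show ?thesis
      using nonadj_count_le[of x ?v] filt len by (auto simp: count_list_filter)
  next
    case False
    then obtain A B where "v = A @ [x, x] @ B"
      using not_nonadj_split[of "{x}" v] by blast
    then show ?thesis by (simp add: successively_append_iff)
  qed
  from alt_square_if_adjacent[OF uv eq ts(1) _ this] ts len that show ?thesis by auto
next
  case True
  then obtain A t B A' B' where split: "u = A @ t # B" "v = A' @ t # B'" "t \<noteq> x"
    "count_list A x \<noteq> count_list A' x"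
    using differ_at_split[OF eq _ ne] by blast
  have dist': "distinct (filter (\<lambda>a. a \<noteq> x) v)" using dist eq by simp
  have cnts: "count_list A x + count_list B x = count_list A' x + count_list B' x"
    using True split by simp
  consider "x \<in> set A" "x \<in> set B" | "x \<in> set A'" "x \<in> set B'"
    | "x \<notin> set A" "x \<notin> set B'" | "x \<notin> set A'" "x \<notin> set B"
    using cnts split(4) count_list_0_iff[of A x] count_list_0_iff[of B x]
      count_list_0_iff[of A' x] count_list_0_iff[of B' x] by fastforce
  then show ?thesis
  proof cases
    case 1
    then show ?thesis
      using alt_square_if_split[OF uv eq dist adj _ split] True that by blast
  next
    case 2
    then show ?thesis
      using alt_square_if_split[OF sym[OF uv] eq[symmetric] dist' _ _ split(2,1,3) split(4)[symmetric]]
        True that by metis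
  next
    case 3
    then show ?thesis
      using alt_square_if_outside[OF uv eq dist adj cnt(1) _ split(1-3)] True that by blast
  next
    case 4
    then show ?thesis
      using alt_square_if_outside[OF sym[OF uv] eq[symmetric] dist' _ _ _ split(2,1,3)]
        True that cnt(1) by metis
  qed
qed

lemma alt_square_if_differ_sym:
  assumes uv: "u \<approx> v" and eq: "filter (\<lambda>a. a \<noteq> x) u = filter (\<lambda>a. a \<noteq> x) v"
    and dist: "distinct (filter (\<lambda>a. a \<noteq> x) u)" and ne: "u \<noteq> v"
    and cnt: "2 \<le> count_list u x" "2 \<le> count_list v x"
    and adj: "nonadj {x} u \<or> nonadj {x} v"
  obtains ts where "distinct (x # ts)" "alt x ts \<approx> [x, x] @ ts"
    "nonadj {x} u \<Longrightarrow> Suc (length ts) \<le> count_list u x"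
    "nonadj {x} v \<Longrightarrow> Suc (length ts) \<le> count_list v x"
\<comment> \<open>Among the words without adjacent \<open>x\<close>, one with the fewest occurrences
  is thinned, so that its length bound holds for the other as well.\<close>
proof (cases "nonadj {x} u \<and> (nonadj {x} v \<longrightarrow> count_list u x \<le> count_list v x)")
  case True
  then show ?thesis
    using alt_square_if_differ[OF uv eq dist _ ne cnt(1)] that by (metis order.refl)
next
  case False
  then have "nonadj {x} v" "nonadj {x} u \<Longrightarrow> count_list v x \<le> count_list u x"
    using adj by auto
  moreover have "distinct (filter (\<lambda>a. a \<noteq> x) v)" using dist eq by simp
  ultimately show ?thesis
    using alt_square_if_differ[OF sym[OF uv] eq[symmetric] _ _ ne[symmetric] cnt(2)] that
    by (metis order.refl)
qed

text \<open>Each letter of \<open>ts\<close> is replaced by the factor of \<open>u\<close> between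
  two chosen occurrences of \<open>x\<close>; everything else goes into the context
  \<open>A\<close>, \<open>B\<close>.\<close>

lemma squared_if_alt_square:
  assumes ts: "distinct (x # ts)" "alt x ts \<approx> [x, x] @ ts" "Suc (length ts) \<le> count_list u x"
  shows "squared u x"
proof -
  have "\<exists>A Gs B. u = A @ [x] @ concat (map (\<lambda>G. G @ [x]) Gs) @ B \<and> length Gs = n"
    if "Suc n \<le> count_list u x" for n
    using that
  proof (induction n arbitrary: u)
    case 0
    then have "x \<in> set u" using count_list_0_iff[of u x] by auto
    then show ?case by (auto dest: split_list)
  next
    case (Suc n)
    then have "x \<in> set u" using count_list_0_iff[of u x] by auto
    then obtain A u' where u: "u = A @ x # u'" "x \<notin> set A" by (meson split_list_first)
    then have "Suc n \<le> count_list u' x" using Suc.prems by (simp add: count_list_0_iff)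
    then obtain G Gs B where "u' = G @ [x] @ concat (map (\<lambda>G. G @ [x]) Gs) @ B" "length Gs = n"
      using Suc.IH by blast
    then show ?case using u(1) by (intro exI[of _ A] exI[of _ "G # Gs"] exI[of _ B]) auto
  qed
  then obtain A Gs B where u: "u = A @ [x] @ concat (map (\<lambda>G. G @ [x]) Gs) @ B" "length Gs = length ts"
    using ts(3) by blast
  define s where "s a = (if a = x then [x] else the (map_of (zip ts Gs) a))" for a
  have Gs: "map s ts = Gs"
  proof (rule nth_equalityI)
    fix i assume "i < length (map s ts)"
    then show "map s ts ! i = Gs ! i"
      using u(2) ts(1) map_of_zip_nth[of ts Gs i] nth_mem[of i ts] by (auto simp: s_def)
  qed (simp add: u(2))
  have "subst s (alt x us) = [x] @ concat (map (\<lambda>G. G @ [x]) (map s us))" for us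
    by (induction us) (auto simp: s_def)
  then have "[x] @ concat (map (\<lambda>G. G @ [x]) (map s ts)) \<approx> subst s [x, x] @ concat (map s ts)"
    using substI[OF ts(2), of s] by (metis subst_def subst_simps(3))
  then have "[x] @ concat (map (\<lambda>G. G @ [x]) Gs) \<approx> [x, x] @ concat Gs"
    by (simp add: Gs) (simp add: s_def)
  then have "u \<approx> A @ [x, x] @ (concat Gs @ B)"
    using cong[of _ _ A B] u(1) by fastforce
  then show ?thesis by (rule squaredI)
qed

end

section \<open>Isoterm pairs\<close>

text \<open>Agreeing words differ only in the order of letters of \<open>M\<close> within the
  stretches between letters outside \<open>M\<close>. When \<open>M\<close> is the complement of the
  simple letters, these stretches are the blocks.\<close>

definition agree :: "letter set \<Rightarrow> word \<Rightarrow> word \<Rightarrow> bool"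
  where "agree M u v \<longleftrightarrow> filter (\<lambda>a. a \<notin> M) u = filter (\<lambda>a. a \<notin> M) v \<and>
    (\<forall>m\<in>M. filter (\<lambda>a. a = m \<or> a \<notin> M) u = filter (\<lambda>a. a = m \<or> a \<notin> M) v)"

lemma agree_Cons: "agree M (c # u) (c # v) \<longleftrightarrow> agree M u v"
  by (auto simp: agree_def)

lemma agree_append: "agree M (p @ u) (p @ v) \<longleftrightarrow> agree M u v"
  by (induction p) (auto simp: agree_Cons)

lemma agree_sym: "agree M u v \<Longrightarrow> agree M v u"
  by (simp add: agree_def)

lemma agree_Nil: "agree M [] v \<Longrightarrow> v = []"
  by (cases v) (auto simp: agree_def split: if_splits)

text \<open>The first stretch of \<open>c # u\<close> inside \<open>M\<close> has at most the letter
  \<open>c\<close>, so there is nothing to reorder.\<close>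

lemma agree_head:
  assumes "agree M (c # u) v" "c \<notin> M \<or> u = [] \<or> hd u \<notin> M"
  obtains v' where "v = c # v'" "agree M u v'"
proof -
  obtain d v' where v: "v = d # v'"
    using assms(1) agree_Nil[OF agree_sym] by (cases v) auto
  have base: "filter (\<lambda>a. a \<notin> M) (c # u) = filter (\<lambda>a. a \<notin> M) (d # v')"
    and letter: "m \<in> M \<Longrightarrow> filter (\<lambda>a. a = m \<or> a \<notin> M) (c # u) = filter (\<lambda>a. a = m \<or> a \<notin> M) (d # v')" for m
    using assms(1) v unfolding agree_def by blast+
  have "c = d"
  proof (cases "c \<in> M")
    case False
    then show ?thesis using base letter[of d] by (cases "d \<in> M") auto
  next
    case c: True
    show ?thesis
    proof (cases "d \<in> M")
      case False
      then show ?thesis using letter[OF c] by auto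
    next
      case True
      then show ?thesis using letter[of d] assms(2) c by (cases u) (auto split: if_splits)
    qed
  qed
  then show ?thesis using that[of v'] assms(1) v by (simp add: agree_Cons)
qed

lemma agree_unique:
  assumes "nonadj M u" "agree M u v"
  shows "u = v"
  using assms
proof (induction u arbitrary: v)
  case Nil
  then show ?case using agree_Nil by auto
next
  case (Cons c u)
  have "c \<notin> M \<or> u = [] \<or> hd u \<notin> M"
    using Cons.prems(1) by (cases u) auto
  then obtain v' where "v = c # v'" "agree M u v'"
    using agree_head[OF Cons.prems(2)] by blast
  moreover have "nonadj M u" using Cons.prems(1) by (cases u) auto
  ultimately show ?case using Cons.IH by simp
qed

lemma agree_swap:
  assumes "agree M (A @ [c, d] @ B) v" "c \<noteq> d" "c \<in> M" "d \<in> M"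
  shows "agree M (A @ [d, c] @ B) v"
  using assms by (auto simp: agree_def)

text \<open>The factor \<open>[x, y]\<close> is the only place where two letters of \<open>M\<close>
  meet, so only their order is free.\<close>

lemma agree_unique_up_to_swap:
  assumes "nonadj M (A @ [x])" "nonadj M (y # B)" "agree M (A @ [x, y] @ B) v"
    "x \<in> M" "y \<in> M" "x \<noteq> y"
  shows "v = A @ [x, y] @ B \<or> v = A @ [y, x] @ B"
  using assms
proof (induction A arbitrary: v)
  case Nil
  obtain d v' where v: "v = d # v'"
    using Nil.prems(3) agree_Nil[OF agree_sym, of M "[] @ [x, y] @ B"] by (cases v) auto
  have B: "B = [] \<or> hd B \<notin> M"
    using Nil.prems(2,5) by (cases B) auto
  have *: "filter (\<lambda>a. a = m \<or> a \<notin> M) (x # y # B) = filter (\<lambda>a. a = m \<or> a \<notin> M) (d # v')"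
    if "m \<in> M" for m
    using that Nil.prems(3) v unfolding agree_def by auto
  have "d \<in> M" using *[of x] Nil.prems(4) by (auto split: if_splits)
  consider "d = x" | "d = y" | "d \<noteq> x" "d \<noteq> y" by blast
  then show ?case
  proof cases
    case 1
    then have "agree M (y # B) v'" using Nil.prems(3) v by (simp add: agree_Cons)
    then show ?thesis using agree_unique[OF Nil.prems(2)] v 1 by auto
  next
    case 2
    have "agree M ([] @ [y, x] @ B) v" using agree_swap[OF Nil.prems(3)] Nil.prems(4-6) by blast
    then have "agree M (x # B) v'" using v 2 by (simp add: agree_Cons)
    moreover have "nonadj M (x # B)" using Nil.prems(2) B by (cases B) auto
    ultimately show ?thesis using agree_unique v 2 by auto
  next
    case 3
    then show ?thesis
      using *[OF \<open>d \<in> M\<close>] B \<open>d \<in> M\<close> Nil.prems(4,5) by (cases B) auto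
  qed
next
  case (Cons c A)
  have "c \<notin> M \<or> A @ [x, y] @ B = [] \<or> hd (A @ [x, y] @ B) \<notin> M"
    using Cons.prems(1) by (cases A) auto
  then obtain v' where v': "v = c # v'" "agree M (A @ [x, y] @ B) v'"
    using agree_head[of M c "A @ [x, y] @ B" v] Cons.prems(3) by auto
  moreover have "nonadj M (A @ [x])" using Cons.prems(1) by (cases A) auto
  ultimately show ?case using Cons.IH[of v'] Cons.prems by auto
qed

lemma filter_adjacent:
  assumes "filter P w = X @ [c, d] @ Y"
  obtains A p B where "w = A @ [c] @ p @ [d] @ B" "\<forall>a\<in>set p. \<not> P a"
  using assms
proof (induction w arbitrary: X thesis)
  case (Cons a w)
  show ?case
  proof (cases "P a \<and> X = []")
    case True
    then have "c = a" "filter P w = d # Y" using Cons.prems(2) by auto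
    then obtain p B where "w = p @ d # B" "\<forall>a\<in>set p. \<not> P a"
      by (auto simp: filter_eq_Cons_iff)
    then show ?thesis using \<open>c = a\<close> by (intro Cons.prems(1)[of "[]" p B]) auto
  next
    case False
    then have "\<exists>X'. filter P w = X' @ [c, d] @ Y"
      using Cons.prems(2) by (cases X) (auto split: if_splits)
    then obtain A p B where "w = A @ [c] @ p @ [d] @ B" "\<forall>a\<in>set p. \<not> P a"
      using Cons.IH by blast
    then show ?thesis by (intro Cons.prems(1)[of "a # A" p B]) auto
  qed
qed simp

lemma not_nonadj_if_twice:
  assumes "w = A @ [b] @ p @ [b] @ B" "set p \<inter> T = {}"
  shows "\<not> nonadj {b} (filter (\<lambda>a. a = b \<or> a \<in> T) w)"
proof -
  have "set (filter (\<lambda>a. a = b \<or> a \<in> T) p) \<subseteq> {b}"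
    using assms(2) by auto
  then show ?thesis
    unfolding assms(1)
    by (cases "filter (\<lambda>a. a = b \<or> a \<in> T) p")
       (auto simp: successively_append_iff successively_Cons)
qed

context A'_theory begin

text \<open>Adjacency after dropping the other multiple letters means that \<open>x\<close> occurs
  twice in one block.\<close>

lemma squared_if_adjacent:
  assumes "2 \<le> count_list w x" "\<not> nonadj {x} (res (insert x (simple w)) w)"
  shows "squared w x"
proof -
  obtain X Y where "res (insert x (simple w)) w = X @ [x, x] @ Y"
    using not_nonadj_split[OF assms(2)] by blast
  then obtain A p B where w: "w = A @ [x] @ p @ [x] @ B"
    and p: "\<forall>a\<in>set p. a \<notin> insert x (simple w)"
    by (rule filter_adjacent)
  show ?thesis
  proof (rule squared_twice_in_block[OF w])
    fix a assume "a \<in> set p"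
    then have "a \<in> set w" "count_list w a \<noteq> 1"
      using p w by (auto simp: simple_def)
    then show "2 \<le> count_list w a"
      using count_list_0_iff[of w a] by linarith
  qed
qed

text \<open>Reduces to words whose only multiple letter is \<open>x\<close>: the simple letters
  stand in the same order on both sides by \<open>simple_order_eq\<close>.\<close>

lemma alt_square_if_res_differ:
  assumes "\<not> commut" "u \<approx> v" "2 \<le> count_list u x"
    and "res (insert x (simple u)) u \<noteq> res (insert x (simple v)) v"
    and "nonadj {x} (res (insert x (simple u)) u) \<or> nonadj {x} (res (insert x (simple v)) v)"
  obtains ts where "distinct (x # ts)" "alt x ts \<approx> [x, x] @ ts"
    "nonadj {x} (res (insert x (simple u)) u) \<Longrightarrow> Suc (length ts) \<le> count_list u x"
    "nonadj {x} (res (insert x (simple v)) v) \<Longrightarrow> Suc (length ts) \<le> count_list v x"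
proof -
  have nid: "\<not> [Lx] \<approx> [Lx, Lx]" using assms(1) idem_imp_commut by blast
  then have nt: "\<not> [] \<approx> [Lx]" using totalD by blast
  have s: "simple u = simple v" by (rule simple_eq[OF nid assms(2)])
  have "x \<in> set v"
    using content_eq[OF nt assms(2)] assms(3) count_list_0_iff[of u x] by auto
  moreover have "x \<notin> simple u" using assms(3) by (simp add: simple_def)
  ultimately have "count_list v x \<noteq> 0" "count_list v x \<noteq> 1"
    using s by (auto simp: simple_def count_list_0_iff)
  then have cnt: "2 \<le> count_list v x" by linarith
  let ?u = "res (insert x (simple u)) u" and ?v = "res (insert x (simple v)) v"
  have fx: "filter (\<lambda>a. a \<noteq> x) ?u = res (simple u) u" "filter (\<lambda>a. a \<noteq> x) ?v = res (simple v) v"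
    using \<open>x \<notin> simple u\<close> s by (auto intro!: filter_cong)
  have E: "?u \<approx> ?v"
    using delete[OF assms(2), of "\<lambda>a. a \<in> insert x (simple u)"] s by simp
  have eq: "filter (\<lambda>a. a \<noteq> x) ?u = filter (\<lambda>a. a \<noteq> x) ?v"
    unfolding fx by (rule simple_order_eq[OF assms(1,2)])
  have d: "distinct (filter (\<lambda>a. a \<noteq> x) ?u)"
    unfolding fx by (rule distinct_res_simple)
  have c: "count_list ?u x = count_list u x" "count_list ?v x = count_list v x"
    by (simp_all add: count_list_filter)
  show ?thesis
    by (rule alt_square_if_differ_sym[OF E eq d assms(4) _ _ assms(5)])
       (use assms(3) cnt that in \<open>auto simp only: c\<close>)
qed

text \<open>Either \<open>x\<close> is twice in a block, or a short enough alternating identity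
  holds. Both depend only on the restriction, hence the extra word \<open>w\<close>: both sides of a
  \<open>kappa\<close> identity are treated this way.\<close>

lemma squared_if_res_differ:
  assumes "\<not> commut" "u \<approx> v" "2 \<le> count_list u x"
    and ne: "res (insert x (simple u)) u \<noteq> res (insert x (simple v)) v"
    and w: "simple w = simple u" "res (insert x (simple u)) w = res (insert x (simple u)) u"
  shows "squared w x"
proof -
  have cnt: "count_list w x = count_list u x"
    using arg_cong[OF w(2), of "\<lambda>w. count_list w x"] by (simp add: count_list_filter)
  show ?thesis
  proof (cases "nonadj {x} (res (insert x (simple u)) u)")
    case True
    then obtain ts where "distinct (x # ts)" "alt x ts \<approx> [x, x] @ ts" "Suc (length ts) \<le> count_list u x"
      using alt_square_if_res_differ[OF assms(1-3) ne] by metis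
    then show ?thesis using squared_if_alt_square cnt by simp
  next
    case False
    then show ?thesis using squared_if_adjacent[of w x] w cnt assms(3) by simp
  qed
qed

end

definition isoterm_pair :: "word \<Rightarrow> word \<Rightarrow> bool"
  where "isoterm_pair w w' \<longleftrightarrow> (\<forall>E. A'_theory E \<longrightarrow> E w w' \<or> (\<forall>v. E w v \<longrightarrow> v = w))"

lemma isoterm_pairI:
  assumes "\<And>E v. A'_theory E \<Longrightarrow> \<not> E w w' \<Longrightarrow> E w v \<Longrightarrow> v = w"
  shows "isoterm_pair w w'"
  using assms unfolding isoterm_pair_def by blast

lemma isoterm_trivial: "isoterm_pair [] [Lx]"
proof (rule isoterm_pairI)
  fix E v
  assume "A'_theory E" and E: "\<not> E [] [Lx]" "E [] v"
  then interpret A'_theory E by simp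
  show "v = []" using content_eq[OF E] by simp
qed

lemma isoterm_idem: "isoterm_pair [Lx] [Lx, Lx]"
proof (rule isoterm_pairI)
  fix E v
  assume "A'_theory E" and E: "\<not> E [Lx] [Lx, Lx]" "E [Lx] v"
  then interpret A'_theory E by simp
  have "\<not> E [] [Lx]" using E(1) totalD by blast
  from content_eq[OF this E(2)] have "set v = {Lx}" by simp
  then have "replicate (length v) Lx = v"
    by (intro replicate_length_same) auto
  moreover have "Lx \<in> simple [Lx]" by (simp add: simple_def)
  then have "Lx \<in> simple v" using simple_eq[OF E] by (simp only:)
  then have "count_list v Lx = 1" by (simp add: simple_def)
  moreover have "count_list (replicate n Lx) Lx = n" for n
    by (induction n) auto
  ultimately show "v = [Lx]" by (metis One_nat_def replicate_0 replicate_Suc)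
qed

lemma isoterm_commut: "isoterm_pair [Lx, Ly] [Ly, Lx]"
proof (rule isoterm_pairI)
  fix E v
  assume "A'_theory E" and E: "\<not> E [Lx, Ly] [Ly, Lx]" "E [Lx, Ly] v"
  then interpret A'_theory E by simp
  have nc: "\<not> commut" using E(1) by (simp add: commut_def)
  then have nid: "\<not> E [Lx] [Lx, Lx]" using idem_imp_commut by blast
  then have "\<not> E [] [Lx]" using totalD by blast
  then have "set v = {Lx, Ly}" using content_eq[OF _ E(2)] by auto
  moreover have s: "simple [Lx, Ly] = {Lx, Ly}" by (auto simp: simple_def split: if_splits)
  then have "simple v = {Lx, Ly}" using simple_eq[OF nid E(2)] by simp
  ultimately have "res (simple v) v = v" by (auto simp: filter_id_conv)
  then show "v = [Lx, Ly]" using simple_order_eq[OF nc E(2)] s by simp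
qed

text \<open>A different word in the class would make \<open>x\<close> a square in
  \<open>alt x ts\<close> by \<open>squared_if_res_differ\<close>, and this is exactly the excluded
  identity.\<close>

lemma isoterm_alt:
  assumes "distinct (x # ts)" "ts \<noteq> []"
  shows "isoterm_pair (alt x ts) ([x, x] @ ts)"
proof (rule isoterm_pairI)
  fix E v
  assume "A'_theory E" and E: "\<not> E (alt x ts) ([x, x] @ ts)" "E (alt x ts) v"
  then interpret A'_theory E by simp
  let ?u = "alt x ts"
  have x: "x \<notin> set ts" using assms(1) by simp
  have cx: "2 \<le> count_list ?u x"
    using assms(2) x by (cases ts) (auto simp: count_list_alt)
  have ct: "count_list ?u t = count_list ts t" if "t \<noteq> x" for t
    using that by (induction ts) auto
  have s: "simple ?u = set ts"
  proof (rule Set.set_eqI)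
    fix t
    have "count_list ts t = 1 \<longleftrightarrow> t \<in> set ts"
      using assms(1) distinct_count_list_le[of ts t] count_list_0_iff[of ts t] by auto
    then show "t \<in> simple ?u \<longleftrightarrow> t \<in> set ts"
      using cx x ct[of t] by (cases "t = x") (auto simp: simple_def)
  qed
  have sq: "\<not> squared ?u x"
    using E(1) filter_alt[OF x] by (simp add: squared_def)
  have nc: "\<not> commut"
  proof
    assume c: commut
    have "mset (alt x us) = mset (replicate (Suc (length us)) x @ us)" for us
      by (induction us) auto
    from commut_mset[OF c this[of ts]]
    have "E ?u (replicate (Suc (length ts)) x @ ts)" .
    also have "E \<dots> ([x, x] @ ts)"
      using cong[OF replicate_square[of "Suc (length ts)" x], of "[]" ts] assms(2)
      by (cases ts) auto
    finally show False using E(1) by simp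
  qed
  then have nid: "\<not> E [Lx] [Lx, Lx]" using idem_imp_commut by blast
  then have "\<not> E [] [Lx]" using totalD by blast
  then have "set v = set ?u" using content_eq[OF _ E(2)] by auto
  then have "res (insert x (simple v)) v = v"
    using simple_eq[OF nid E(2)] s by (auto simp: filter_id_conv set_alt)
  moreover have "res (insert x (simple ?u)) ?u = ?u"
    unfolding s by (auto simp: filter_id_conv set_alt)
  ultimately show "v = ?u"
    using squared_if_res_differ[OF nc E(2) cx _ HOL.refl HOL.refl] sq by auto
qed

text \<open>The left side of the second family of isoterm pairs; exchanging the arguments
  \<open>x\<close> and \<open>y\<close> gives the right side. Each outer occurrence is paired with
  the simple letter next to it on the side of the middle.\<close>

definition kappa :: "(letter \<times> letter) list \<Rightarrow> letter \<Rightarrow> letter \<Rightarrow> (letter \<times> letter) list \<Rightarrow> word"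
  where "kappa ps x y qs =
    concat (map (\<lambda>(c, t). [c, t]) ps) @ [x, y] @ concat (map (\<lambda>(t, c). [t, c]) qs)"

lemma nonadj_pairs_left:
  "set (map snd ps) \<inter> M = {} \<Longrightarrow> nonadj M (concat (map (\<lambda>(c, t). [c, t]) ps) @ [x])"
  by (induction ps) (auto simp: successively_Cons)

lemma nonadj_pairs_right:
  "set (map fst qs) \<inter> M = {} \<Longrightarrow> nonadj M (x # concat (map (\<lambda>(t, c). [t, c]) qs))"
  by (induction qs arbitrary: x) (auto simp: successively_Cons)

text \<open>If a word in the class places \<open>x\<close> or \<open>y\<close> differently among the
  simple letters, that letter is a square in both sides; without it they coincide, so the identity
  holds. Otherwise the word agrees with the left side, and only the two sides do so.\<close>

lemma isoterm_kappa:
  assumes xy: "x \<noteq> y" and ps: "set (map fst ps) \<subseteq> {x, y}" and qs: "set (map snd qs) \<subseteq> {x, y}"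
    and dist: "distinct (map snd ps @ map fst qs)" "set (map snd ps @ map fst qs) \<inter> {x, y} = {}"
    and cx: "2 \<le> count_list (kappa ps x y qs) x" and cy: "2 \<le> count_list (kappa ps x y qs) y"
  shows "isoterm_pair (kappa ps x y qs) (kappa ps y x qs)"
proof (rule isoterm_pairI)
  fix E v
  let ?u = "kappa ps x y qs" and ?u' = "kappa ps y x qs"
  assume "A'_theory E" and E: "\<not> E ?u ?u'" "E ?u v"
  then interpret A'_theory E by simp
  define T where "T = set (map snd ps @ map fst qs)"
  have filtT: "filter (\<lambda>a. a \<notin> {x, y}) ?u = map snd ps @ map fst qs"
  proof -
    have "filter (\<lambda>a. a \<notin> {x, y}) (concat (map (\<lambda>(c, t). [c, t]) ps)) = map snd ps"
      using ps dist(2) by (induction ps) auto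
    moreover have "filter (\<lambda>a. a \<notin> {x, y}) (concat (map (\<lambda>(t, c). [t, c]) qs)) = map fst qs"
      using qs dist(2) by (induction qs) auto
    ultimately show ?thesis by (simp add: kappa_def)
  qed
  have su: "set ?u = {x, y} \<union> T"
  proof -
    have "set (filter (\<lambda>a. a \<notin> {x, y}) ?u) = T" unfolding filtT T_def ..
    moreover have "x \<in> set ?u" "y \<in> set ?u" by (simp_all add: kappa_def)
    ultimately show ?thesis by auto
  qed
  have s: "simple ?u = T"
  proof (rule Set.set_eqI)
    fix t
    show "t \<in> simple ?u \<longleftrightarrow> t \<in> T"
    proof (cases "t \<in> {x, y}")
      case True
      then show ?thesis using cx cy dist(2) by (auto simp: simple_def T_def)
    next
      case False
      then have "count_list ?u t = count_list (map snd ps @ map fst qs) t"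
        using arg_cong[OF filtT, of "\<lambda>w. count_list w t"] by (simp add: count_list_filter)
      moreover have "count_list (map snd ps @ map fst qs) t = 1 \<longleftrightarrow> t \<in> T"
        using distinct_count_list_le[OF dist(1), of t] count_list_0_iff[of "map snd ps @ map fst qs" t]
        unfolding T_def by auto
      ultimately show ?thesis by (simp add: simple_def)
    qed
  qed
  have mset: "mset ?u = mset ?u'" by (simp add: kappa_def)
  have nc: "\<not> commut" using E(1) commut_mset[OF _ mset] by blast
  then have nid: "\<not> E [Lx] [Lx, Lx]" using idem_imp_commut by blast
  then have nt: "\<not> E [] [Lx]" using totalD by blast
  have sv: "simple v = T" using simple_eq[OF nid E(2)] s by simp
  have setv: "set v = {x, y} \<union> T" using content_eq[OF nt E(2)] su by simp
  have s': "simple ?u' = simple ?u" by (auto simp: simple_def kappa_def)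
  have "res (insert z T) ?u = res (insert z T) v" if z: "z \<in> {x, y}" for z
  proof (rule ccontr)
    assume "res (insert z T) ?u \<noteq> res (insert z T) v"
    then have ne: "res (insert z (simple ?u)) ?u \<noteq> res (insert z (simple v)) v"
      using s sv by simp
    have cz: "2 \<le> count_list ?u z" using z cx cy by auto
    have "res (insert z (simple ?u)) ?u' = res (insert z (simple ?u)) ?u"
      using z xy dist(2) unfolding s T_def by (auto simp: kappa_def)
    then have "squared ?u z" "squared ?u' z"
      using squared_if_res_differ[OF nc E(2) cz ne] s' by simp_all
    moreover have "filter (\<lambda>a. a \<noteq> z) ?u = filter (\<lambda>a. a \<noteq> z) ?u'"
      using z by (auto simp: kappa_def)
    ultimately have "E ?u ?u'"
      using trans[OF _ sym] unfolding squared_def by metis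
    then show False using E(1) by simp
  qed
  moreover have "filter (\<lambda>a. a = z \<or> a \<notin> {x, y}) w = res (insert z T) w"
    if "z \<in> {x, y}" "set w = {x, y} \<union> T" for z w
    using that dist(2) by (intro filter_cong) (auto simp: T_def)
  moreover have "filter (\<lambda>a. a \<notin> {x, y}) w = res T w" if "set w = {x, y} \<union> T" for w
    using that dist(2) by (intro filter_cong) (auto simp: T_def)
  moreover have "res T ?u = res T v"
    using simple_order_eq[OF nc E(2)] s sv by simp
  ultimately have "agree {x, y} ?u v"
    unfolding agree_def using su setv by simp
  then have "v = ?u \<or> v = ?u'"
    unfolding kappa_def
    by (intro agree_unique_up_to_swap[of "{x, y}"] nonadj_pairs_left nonadj_pairs_right)
       (use xy dist(2) in auto)
  then show "v = ?u" using E by auto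
qed

section \<open>Sorting the letters inside blocks\<close>

lemma split_after_letters:
  obtains A0 gs where "A = A0 @ concat (map (\<lambda>(c, G). c # G) gs)" "map fst gs = res M A"
proof (induction A arbitrary: thesis)
  case Nil
  then show ?case by (metis append_Nil concat.simps(1) filter.simps(1) list.simps(8))
next
  case (Cons a A)
  obtain A0 gs where *: "A = A0 @ concat (map (\<lambda>(c, G). c # G) gs)" "map fst gs = res M A"
    using Cons.IH by blast
  show ?case
  proof (cases "a \<in> M")
    case True
    then show ?thesis using * by (intro Cons.prems[of "[]" "(a, A0) # gs"]) auto
  next
    case False
    then show ?thesis using * by (intro Cons.prems[of "a # A0" gs]) auto
  qed
qed

lemma split_before_letters:
  obtains B0 gs where "B = concat (map (\<lambda>(G, c). G @ [c]) gs) @ B0" "map snd gs = res M B"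
proof -
  obtain A0 gs where *: "rev B = A0 @ concat (map (\<lambda>(c, G). c # G) gs)" "map fst gs = res M (rev B)"
    by (rule split_after_letters)
  have "B = concat (map (\<lambda>(G, c). G @ [c]) (rev (map (\<lambda>(c, G). (rev G, c)) gs))) @ rev A0"
    using arg_cong[OF *(1), of rev] by (simp add: rev_concat rev_map comp_def case_prod_beta)
  moreover have "map snd (rev (map (\<lambda>(c, G). (rev G, c)) gs)) = res M B"
    using arg_cong[OF *(2), of rev] by (simp add: rev_map rev_filter comp_def case_prod_beta)
  ultimately show ?thesis by (rule that)
qed

text \<open>Mirror of \<open>thin_gaps\<close>. The letter \<open>g\<close> stands for the middle
  pair of a \<open>kappa\<close> word, so that a separator is also kept between the last letter of
  \<open>M\<close> in \<open>A\<close> and this pair.\<close>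

lemma thin_gaps_before:
  assumes "nonadj M (A @ [g])" "distinct (filter (\<lambda>a. a \<notin> M) A)" "g \<in> M"
  obtains ps where "res (M \<union> set (map snd ps)) A = concat (map (\<lambda>(c, t). [c, t]) ps)"
    "set (map snd ps) \<subseteq> set A - M" "set (map fst ps) \<subseteq> M" "distinct (map snd ps)"
proof -
  have "nonadj M (rev (A @ [g]))"
    using assms(1) unfolding successively_rev by (simp add: disj_commute)
  then have "nonadj M (g # rev A)" by simp
  moreover have "distinct (filter (\<lambda>a. a \<notin> M) (g # rev A))"
    using assms by (simp add: rev_filter[symmetric])
  ultimately obtain m ps where
    *: "res (M \<union> set (map fst ps)) (g # rev A) = m # concat (map (\<lambda>(t, c). [t, c]) ps)"
    "set (map fst ps) \<subseteq> set (g # rev A) - M" "set (map snd ps) \<subseteq> M" "distinct (map fst ps)"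
    using assms(3) by (elim thin_gaps) auto
  let ?ps = "rev (map (\<lambda>(t, c). (c, t)) ps)"
  have "rev (res (M \<union> set (map fst ps)) A) = concat (map (\<lambda>(t, c). [t, c]) ps)"
    using *(1) assms(3) by (simp add: rev_filter)
  from arg_cong[OF this, of rev]
  have "res (M \<union> set (map fst ps)) A = concat (map (\<lambda>(c, t). [c, t]) ?ps)"
    by (simp add: rev_concat rev_map comp_def case_prod_beta)
  moreover have "map snd ?ps = rev (map fst ps)" "map fst ?ps = rev (map snd ps)"
    by (simp_all add: rev_map comp_def case_prod_beta)
  ultimately show ?thesis
    using * assms(3) by (intro that[of ?ps]) (simp_all only: set_rev distinct_rev, auto)
qed

lemma thin_gaps_after:
  assumes "nonadj M (d # B)" "distinct (filter (\<lambda>a. a \<notin> M) B)" "d \<in> M"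
  obtains qs where "res (M \<union> set (map fst qs)) B = concat (map (\<lambda>(t, c). [t, c]) qs)"
    "set (map fst qs) \<subseteq> set B - M" "set (map snd qs) \<subseteq> M" "distinct (map fst qs)"
proof -
  obtain m qs where
    *: "res (M \<union> set (map fst qs)) (d # B) = m # concat (map (\<lambda>(t, c). [t, c]) qs)"
    "set (map fst qs) \<subseteq> set (d # B) - M" "set (map snd qs) \<subseteq> M" "distinct (map fst qs)"
    using assms by (elim thin_gaps) auto
  show ?thesis
    by (rule that[of qs]) (use * assms(3) in auto)
qed

context A'_theory begin

text \<open>The outer occurrences in the \<open>kappa\<close> word match those of \<open>g\<close>
  and \<open>d\<close> in \<open>A\<close> and \<open>B\<close> one by one, so its simple letters
  can be replaced by the gaps between the latter.\<close>

lemma kappa_apply: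
  assumes k: "kappa ps g d qs \<approx> kappa ps d g qs"
    and ps: "map fst ps = res {g, d} A" and qs: "map snd qs = res {g, d} B"
    and dist: "distinct (map snd ps @ map fst qs)" "set (map snd ps @ map fst qs) \<inter> {g, d} = {}"
  shows "A @ [g, d] @ B \<approx> A @ [d, g] @ B"
proof -
  obtain A0 as where A: "A = A0 @ concat (map (\<lambda>(c, G). c # G) as)" "map fst as = res {g, d} A"
    by (rule split_after_letters)
  obtain B0 bs where B: "B = concat (map (\<lambda>(G, c). G @ [c]) bs) @ B0" "map snd bs = res {g, d} B"
    by (rule split_before_letters)
  define ts Gs where "ts = map snd ps @ map fst qs" and "Gs = map snd as @ map fst bs"
  define s where "s a = (if a \<in> {g, d} then [a] else the (map_of (zip ts Gs) a))" for a
  have len: "length ps = length as" "length qs = length bs"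
    using arg_cong[OF ps, of length] arg_cong[OF A(2), of length]
      arg_cong[OF qs, of length] arg_cong[OF B(2), of length] by simp_all
  have "map s ts = Gs"
  proof (rule nth_equalityI)
    fix i assume "i < length (map s ts)"
    moreover have "length ts = length Gs" using len by (simp add: ts_def Gs_def)
    ultimately show "map s ts ! i = Gs ! i"
      using dist map_of_zip_nth[of ts Gs i] nth_mem[of i ts] unfolding ts_def[symmetric]
      by (auto simp: s_def)
  qed (simp add: ts_def Gs_def len)
  then have s: "map s (map snd ps) = map snd as" "map s (map fst qs) = map fst bs"
    using len by (simp_all add: ts_def Gs_def)
  have gd: "s g = [g]" "s d = [d]" by (simp_all add: s_def)
  have L: "subst s (concat (map (\<lambda>(c, t). [c, t]) ps)) = concat (map (\<lambda>(c, G). c # G) as)"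
  proof -
    have "map fst ps = map fst as" "set (map fst ps) \<subseteq> {g, d}"
      using ps A(2) by auto
    then show ?thesis using s(1)
    proof (induction ps arbitrary: as)
      case (Cons p ps)
      then show ?case by (cases p; cases as) (auto simp: gd)
    qed simp
  qed
  have R: "subst s (concat (map (\<lambda>(t, c). [t, c]) qs)) = concat (map (\<lambda>(G, c). G @ [c]) bs)"
  proof -
    have "map snd qs = map snd bs" "set (map snd qs) \<subseteq> {g, d}"
      using qs B(2) by auto
    then show ?thesis using s(2)
    proof (induction qs arbitrary: bs)
      case (Cons p qs)
      then show ?case by (cases p; cases bs) (auto simp: gd)
    qed simp
  qed
  have "subst s (kappa ps x y qs) = concat (map (\<lambda>(c, G). c # G) as) @ [x, y] @
      concat (map (\<lambda>(G, c). G @ [c]) bs)" if "x \<in> {g, d}" "y \<in> {g, d}" for x y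
    using that unfolding kappa_def by (auto simp: L R gd)
  with substI[OF k, of s] show ?thesis
    using cong[of _ _ A0 B0] by (fastforce simp: A(1) B(1))
qed

text \<open>The factor from \<open>c\<close> to \<open>c'\<close> lies to the left of the exchanged
  pair, so the reversed form of \<open>swap_adjacent\<close> is needed; the two orders of
  \<open>c\<close> and \<open>c'\<close> differ by symmetry of the theory.\<close>

lemma swap_if_left:
  assumes "distinct p" "set p \<subseteq> set A1 \<union> set A2 \<union> set B" "{c, c'} = {g, d}"
  shows "(A1 @ [c] @ p @ [c'] @ A2) @ [g, d] @ B \<approx> (A1 @ [c] @ p @ [c'] @ A2) @ [d, g] @ B"
proof -
  have *: "(A1 @ [c] @ p @ [c'] @ A2) @ [c, c'] @ B \<approx> (A1 @ [c] @ p @ [c'] @ A2) @ [c', c] @ B"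
    using swap_adjacent(2)[of "rev p" "rev B" "rev A2" "rev A1" "[c']" "[c]"] assms(1,2) by auto
  from assms(3) consider "c = g" "c' = d" | "c = d" "c' = g"
    by (auto simp: doubleton_eq_iff)
  then show ?thesis using * sym[OF *] by cases auto
qed

lemma swap_if_right:
  assumes "distinct p" "set p \<subseteq> set A \<union> set B1 \<union> set B2" "{c, c'} = {g, d}"
  shows "A @ [g, d] @ (B1 @ [c] @ p @ [c'] @ B2) \<approx> A @ [d, g] @ (B1 @ [c] @ p @ [c'] @ B2)"
proof -
  have *: "A @ [c, c'] @ (B1 @ [c] @ p @ [c'] @ B2) \<approx> A @ [c', c] @ (B1 @ [c] @ p @ [c'] @ B2)"
    using swap_adjacent(1)[of p A B1 B2 "[c]" "[c']"] assms(1,2) by auto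
  from assms(3) consider "c = g" "c' = d" | "c = d" "c' = g"
    by (auto simp: doubleton_eq_iff)
  then show ?thesis using * sym[OF *] by cases auto
qed

end

section \<open>Comparison of two theories through their isoterm pairs\<close>

locale theory_pair = A: A'_theory E + B: A'_theory F
  for E F :: "word \<Rightarrow> word \<Rightarrow> bool" +
  assumes transfer: "isoterm_pair w w' \<Longrightarrow> E w w' \<Longrightarrow> F w w'"
begin

text \<open>Thinning the simple letters of \<open>T\<close> turns the exchange into a
  \<open>kappa\<close> identity of \<open>E\<close>. Being an isoterm pair, it passes to
  \<open>F\<close>, and \<open>kappa_apply\<close> carries it back to \<open>w\<close> in both
  theories.\<close>

lemma swap_if_no_common_block:
  assumes T: "T \<inter> {g, d} = {}" "distinct (res T w)" and gd: "g \<noteq> d"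
    and w: "w = A @ [g, d] @ B"
    and cnt: "2 \<le> count_list w g" "2 \<le> count_list w d"
    and adj: "nonadj {g, d} (res ({g, d} \<union> T) A @ [g])" "nonadj {g, d} (d # res ({g, d} \<union> T) B)"
    and E: "E (res ({g, d} \<union> T) w) (res ({g, d} \<union> T) (A @ [d, g] @ B))"
  shows "E w (A @ [d, g] @ B) \<and> F w (A @ [d, g] @ B)"
proof -
  let ?M = "{g, d}"
  define A0 B0 where "A0 = res (?M \<union> T) A" and "B0 = res (?M \<union> T) B"
  have fA: "filter (\<lambda>a. a \<notin> ?M) A0 = res T A" "filter (\<lambda>a. a \<notin> ?M) B0 = res T B"
    unfolding A0_def B0_def filter_filter using T(1) by (auto intro!: filter_cong)
  have dist: "distinct (res T A)" "distinct (res T B)" "set (res T A) \<inter> set (res T B) = {}"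
    using T by (auto simp: w)
  obtain ps where ps: "res (?M \<union> set (map snd ps)) A0 = concat (map (\<lambda>(c, t). [c, t]) ps)"
    "set (map snd ps) \<subseteq> set A0 - ?M" "set (map fst ps) \<subseteq> ?M" "distinct (map snd ps)"
    by (rule thin_gaps_before[of ?M A0 g]) (use adj dist fA A0_def in auto)
  obtain qs where qs: "res (?M \<union> set (map fst qs)) B0 = concat (map (\<lambda>(t, c). [t, c]) qs)"
    "set (map fst qs) \<subseteq> set B0 - ?M" "set (map snd qs) \<subseteq> ?M" "distinct (map fst qs)"
    by (rule thin_gaps_after[of ?M d B0]) (use adj dist fA B0_def in auto)
  have sets: "set A0 - ?M = set (res T A)" "set B0 - ?M = set (res T B)"
    using arg_cong[OF fA(1), of set] arg_cong[OF fA(2), of set] by auto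
  define D where "D = ?M \<union> set (map snd ps) \<union> set (map fst qs)"
  have "set A0 \<inter> set (map fst qs) = {}" "set B0 \<inter> set (map snd ps) = {}"
    using ps(2) qs(2) sets dist(3) by blast+
  then have D: "res D A0 = concat (map (\<lambda>(c, t). [c, t]) ps)" "res D B0 = concat (map (\<lambda>(t, c). [t, c]) qs)"
    unfolding ps(1)[symmetric] qs(1)[symmetric] D_def
    by (auto intro!: filter_cong)
  have k: "res D (res (?M \<union> T) (A @ [x, y] @ B)) = kappa ps x y qs" if "x \<in> ?M" "y \<in> ?M" for x y
  proof -
    have "res D (res (?M \<union> T) (A @ [x, y] @ B)) = res D A0 @ [x, y] @ res D B0"
      using that by (auto simp: A0_def B0_def D_def)
    then show ?thesis by (simp only: D kappa_def)
  qed
  have Ek: "E (kappa ps g d qs) (kappa ps d g qs)"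
    using A.delete[OF E, of "\<lambda>a. a \<in> D"] k[of g d] k[of d g] by (simp add: w)
  have cntk: "count_list (kappa ps g d qs) z = count_list w z" if "z \<in> ?M" for z
  proof -
    have "count_list (kappa ps g d qs) z = count_list (res D (res (?M \<union> T) w)) z"
      unfolding w using k[of g d] by simp
    then show ?thesis using that by (simp only: count_list_filter) (auto simp: D_def)
  qed
  have "set (map snd ps) \<inter> set (map fst qs) = {}"
    using ps(2) qs(2) sets dist(3) by blast
  then have d1: "distinct (map snd ps @ map fst qs)"
    using ps(4) qs(4) by (simp only: distinct_append)
  have d2: "set (map snd ps @ map fst qs) \<inter> ?M = {}"
    using ps(2) qs(2) by auto
  have "isoterm_pair (kappa ps g d qs) (kappa ps d g qs)"
    using isoterm_kappa[OF gd ps(3) qs(3) d1 d2] cnt cntk by simp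
  then have Fk: "F (kappa ps g d qs) (kappa ps d g qs)"
    using transfer Ek by blast
  have mA: "map fst ps = res ?M A"
  proof -
    have "res ?M (concat (map (\<lambda>(c, t). [c, t]) ps)) = map fst ps"
      using ps(3) d2 by (induction ps) auto
    moreover have "res ?M (res D A0) = res ?M A"
      unfolding A0_def D_def filter_filter by (auto intro!: filter_cong)
    ultimately show ?thesis using D(1) by simp
  qed
  have mB: "map snd qs = res ?M B"
  proof -
    have "res ?M (concat (map (\<lambda>(t, c). [t, c]) qs)) = map snd qs"
      using qs(3) d2 by (induction qs) auto
    moreover have "res ?M (res D B0) = res ?M B"
      unfolding B0_def D_def filter_filter by (auto intro!: filter_cong)
    ultimately show ?thesis using D(2) by simp
  qed
  show ?thesis
    using A.kappa_apply[OF Ek mA mB d1 d2] B.kappa_apply[OF Fk mA mB d1 d2] by (simp add: w)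
qed

end

text \<open>
  \<open>v\<close> is the word towards which \<open>w\<close> is sorted; \<open>T\<close> is the set of its simple letters, and no
  letter occurs twice in a block of \<open>v\<close>.
\<close>

locale block_sorting = theory_pair +
  fixes T :: "letter set" and v :: word
  assumes T_distinct: "distinct (res T v)"
    and multiple: "b \<in> set v \<Longrightarrow> b \<notin> T \<Longrightarrow> 2 \<le> count_list v b"
    and no_square: "b \<notin> T \<Longrightarrow> nonadj {b} (filter (\<lambda>a. a = b \<or> a \<in> T) v)"
begin

lemma agree_filter:
  assumes "agree (-T) w v"
  shows "b \<notin> T \<Longrightarrow> filter (\<lambda>a. a = b \<or> a \<in> T) w = filter (\<lambda>a. a = b \<or> a \<in> T) v"
    and "res T w = res T v"
  using assms by (auto simp: agree_def)

lemma agree_no_square: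
  assumes "agree (-T) w v" "w = X @ [b] @ q @ [b] @ Y" "set q \<inter> T = {}" "b \<notin> T"
  shows False
  using not_nonadj_if_twice[OF assms(2,3)] no_square[OF assms(4)] agree_filter(1)[OF assms(1,4)]
  by simp

lemma agree_multiple:
  assumes "agree (-T) w v" "b \<in> set w" "b \<notin> T"
  shows "2 \<le> count_list w b"
proof -
  have "count_list w b = count_list v b"
    using arg_cong[OF agree_filter(1)[OF assms(1,3)], of "\<lambda>w. count_list w b"]
    by (simp add: count_list_filter)
  then show ?thesis
    using multiple[OF _ assms(3)] assms(2) count_list_0_iff[of w b] count_list_0_iff[of v b] by auto
qed

text \<open>Provides what \<open>swap_adjacent\<close> demands of the factor between the two
  letters.\<close>

lemma agree_block_factor:
  assumes "agree (-T) w v" "w = X @ p @ Y" "set p \<inter> T = {}"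
  shows "distinct p" "set p \<subseteq> set X \<union> set Y"
proof -
  show dist: "distinct p"
  proof (rule ccontr)
    assume "\<not> distinct p"
    then obtain p1 b p2 p3 where p: "p = p1 @ [b] @ p2 @ [b] @ p3"
      by (meson not_distinct_decomp)
    then show False
      using agree_no_square[OF assms(1), of "X @ p1" b p2 "p3 @ Y"] assms(2,3) by auto
  qed
  show "set p \<subseteq> set X \<union> set Y"
  proof
    fix b assume b: "b \<in> set p"
    then have "2 \<le> count_list w b"
      using agree_multiple[OF assms(1)] assms(2,3) by auto
    then have "count_list X b \<noteq> 0 \<or> count_list Y b \<noteq> 0"
      using distinct_count_list_le[OF dist, of b] assms(2) by auto
    then show "b \<in> set X \<union> set Y" by (simp add: count_list_0_iff)
  qed
qed

text \<open>If \<open>g\<close> and \<open>d\<close> share another block, to the left or to the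
  right, a \<open>c\<close> or \<open>d\<close> identity exchanges them. Otherwise the restrictions
  of \<open>w\<close> and \<open>v\<close> to \<open>g\<close>, \<open>d\<close> and
  \<open>T\<close> can differ only in the order of this pair, and they do differ, so
  \<open>E\<close> contains the exchange after deletion and \<open>swap_if_no_common_block\<close>
  applies.\<close>

lemma swap_step:
  assumes E: "E w v" and agree: "agree (-T) w v"
    and w: "w = P @ G @ [g, d] @ B" and v: "v = P @ d # v'"
    and G: "set G \<inter> T = {}" "d \<notin> set G" and T: "g \<notin> T" "d \<notin> T" "g \<noteq> d"
  shows "E w (P @ G @ [d, g] @ B) \<and> F w (P @ G @ [d, g] @ B)"
proof -
  let ?M = "{g, d}"
  let ?R = "?M \<union> T"
  note nosq = agree_no_square[OF agree]
  define A where "A = P @ G"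
  have w': "w = A @ [g, d] @ B" by (simp add: w A_def)
  consider (left) "\<not> nonadj ?M (res ?R (A @ [g]))" | (right) "\<not> nonadj ?M (res ?R (d # B))"
    | (none) "nonadj ?M (res ?R (A @ [g]))" "nonadj ?M (res ?R (d # B))"
    by blast
  then have "E w (A @ [d, g] @ B) \<and> F w (A @ [d, g] @ B)"
  proof cases
    case left
    then obtain X c c' Y where "res ?R (A @ [g]) = X @ [c, c'] @ Y" and cM: "c \<in> ?M" "c' \<in> ?M"
      by (rule not_nonadj_split)
    then obtain A1 p A2 where A: "A @ [g] = A1 @ [c] @ p @ [c'] @ A2" and p: "\<forall>a\<in>set p. a \<notin> ?R"
      by (metis (no_types, lifting) filter_adjacent)
    have wA: "w = A1 @ [c] @ p @ [c'] @ A2 @ [d] @ B"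
      using arg_cong[OF A, of "\<lambda>z. z @ [d] @ B"] w' by simp
    have pT: "set p \<inter> T = {}" using p by auto
    have ne: "c \<noteq> c'"
      using nosq[of A1 c p] wA pT cM T by auto
    \<comment> \<open>The found pair does not end in the displayed \<open>g\<close>: then
      \<open>c\<close> would be \<open>d\<close>, which would occur twice in one block.\<close>
    have "A2 \<noteq> []"
    proof
      assume A2: "A2 = []"
      then have "c' = g" using arg_cong[OF A, of last] by simp
      then show False
        using nosq[of A1 d "p @ [g]" B] wA A2 cM ne pT T by auto
    qed
    then obtain A2' where A2: "A2 = A2' @ [g]" "A = A1 @ [c] @ p @ [c'] @ A2'"
      using A by (cases A2 rule: rev_cases) auto
    have dp: "distinct p" and "set p \<subseteq> set (A1 @ [c]) \<union> set ([c'] @ A2' @ [g, d] @ B)"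
      using agree_block_factor[OF agree _ pT, of "A1 @ [c]" "[c'] @ A2' @ [g, d] @ B"] wA A2 by auto
    then have sp: "set p \<subseteq> set A1 \<union> set A2' \<union> set B"
      using p cM by auto
    have cc: "{c, c'} = {g, d}" using cM ne by auto
    show ?thesis
      unfolding w' A2(2)
      using A.swap_if_left[OF dp sp cc] B.swap_if_left[OF dp sp cc] by (rule conjI)
  next
    case right
    then obtain X c c' Y where "res ?R (d # B) = X @ [c, c'] @ Y" and cM: "c \<in> ?M" "c' \<in> ?M"
      by (rule not_nonadj_split)
    then obtain B1 p B2 where B: "d # B = B1 @ [c] @ p @ [c'] @ B2" and p: "\<forall>a\<in>set p. a \<notin> ?R"
      by (metis (no_types, lifting) filter_adjacent)
    have wB: "w = A @ [g] @ B1 @ [c] @ p @ [c'] @ B2"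
      using arg_cong[OF B, of "\<lambda>z. A @ [g] @ z"] w' by simp
    have pT: "set p \<inter> T = {}" using p by auto
    have ne: "c \<noteq> c'"
      using nosq[of "A @ [g] @ B1" c p] wB pT cM T by auto
    have "B1 \<noteq> []"
    proof
      assume B1: "B1 = []"
      then have "c = d" using B by simp
      then show False
        using nosq[of A g "[d] @ p" B2] wB B1 cM ne pT T by auto
    qed
    then obtain B1' where B1: "B1 = d # B1'" "B = B1' @ [c] @ p @ [c'] @ B2"
      using B by (cases B1) auto
    have dp: "distinct p" and "set p \<subseteq> set (A @ [g, d] @ B1' @ [c]) \<union> set ([c'] @ B2)"
      using agree_block_factor[OF agree _ pT, of "A @ [g, d] @ B1' @ [c]" "[c'] @ B2"] wB B1 by auto
    then have sp: "set p \<subseteq> set A \<union> set B1' \<union> set B2"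
      using p cM by auto
    have cc: "{c, c'} = {g, d}" using cM ne by auto
    show ?thesis
      unfolding w' B1(2)
      using A.swap_if_right[OF dp sp cc] B.swap_if_right[OF dp sp cc] by (rule conjI)
  next
    case none
    have adj: "nonadj ?M (res ?R A @ [g])" "nonadj ?M (d # res ?R B)"
      using none by simp_all
    have "agree ?M (res ?R w) (res ?R v)"
    proof -
      have "filter (\<lambda>a. a \<notin> ?M) (res ?R u) = res T u" for u
        unfolding filter_filter using T by (auto intro!: filter_cong)
      moreover have "filter (\<lambda>a. a = m \<or> a \<notin> ?M) (res ?R u) = filter (\<lambda>a. a = m \<or> a \<in> T) u"
        if "m \<in> ?M" for m u
        unfolding filter_filter using T that by (auto intro!: filter_cong)
      ultimately show ?thesis
        unfolding agree_def using agree_filter[OF agree] T by auto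
    qed
    then have "agree ?M (res ?R A @ [g, d] @ res ?R B) (res ?R v)" by (simp add: w')
    then have "res ?R v = res ?R A @ [g, d] @ res ?R B \<or> res ?R v = res ?R A @ [d, g] @ res ?R B"
      using agree_unique_up_to_swap[OF adj] T by auto
    \<comment> \<open>After \<open>P\<close>, the restriction of \<open>v\<close> starts with
      \<open>d\<close>, whereas the unswapped word starts with a letter of \<open>G\<close> or with
      \<open>g\<close>.\<close>
    moreover have "res ?R v \<noteq> res ?R A @ [g, d] @ res ?R B"
    proof
      assume "res ?R v = res ?R A @ [g, d] @ res ?R B"
      then have *: "d # res ?R v' = res ?R G @ [g, d] @ res ?R B"
        by (simp add: v A_def)
      show False
      proof (cases "res ?R G")
        case Nil
        then show False using * T by simp
      next
        case (Cons a G')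
        then have "d \<in> set (res ?R G)" using * by simp
        then show False using G(2) by simp
      qed
    qed
    ultimately have "E (res ?R w) (res ?R (A @ [d, g] @ B))"
      using A.delete[OF E, of "\<lambda>a. a \<in> ?R"] by simp
    moreover have "distinct (res T w)" using agree_filter(2)[OF agree] T_distinct by simp
    moreover have "2 \<le> count_list w g" "2 \<le> count_list w d"
      by (rule agree_multiple[OF agree]; use T w in simp)+
    ultimately show ?thesis
      using swap_if_no_common_block[OF _ _ T(3) w' _ _ adj] T by blast
  qed
  then show ?thesis by (simp add: A_def)
qed

lemma move_left:
  assumes "E w v" "agree (-T) w v" "w = P @ G @ d # B" "v = P @ d # v'"
    "set G \<inter> T = {}" "d \<notin> set G" "d \<notin> T"
  shows "E w (P @ d # G @ B) \<and> F w (P @ d # G @ B) \<and> agree (-T) (P @ d # G @ B) v"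
  using assms
proof (induction G arbitrary: w B rule: rev_induct)
  case Nil
  then show ?case by simp
next
  case (snoc g G)
  let ?w = "P @ G @ [d, g] @ B"
  have g: "g \<notin> T" "g \<noteq> d" using snoc.prems by auto
  have *: "E w ?w" "F w ?w"
    using swap_step[OF snoc.prems(1,2) _ snoc.prems(4), of G g B] snoc.prems g by simp_all
  have "agree (-T) ?w v"
    using agree_swap[of "-T" "P @ G" g d B v] snoc.prems g by simp
  moreover have "E ?w v" by (rule A.trans[OF A.sym[OF *(1)] snoc.prems(1)])
  ultimately have "E ?w (P @ d # G @ g # B) \<and> F ?w (P @ d # G @ g # B) \<and> agree (-T) (P @ d # G @ g # B) v"
    using snoc.IH[of ?w "g # B"] snoc.prems by simp
  then show ?case
    using A.trans[OF *(1)] B.trans[OF *(2)] by simp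
qed

text \<open>Insertion sort along \<open>v\<close>, with \<open>P\<close> the part already in place.
  The next letter of \<open>v\<close> is in place if it lies in \<open>T\<close>, and otherwise
  \<open>move_left\<close> brings it there.\<close>

lemma sort_blocks:
  assumes "E w v" "agree (-T) w v" "w = P @ w'" "v = P @ v'"
  shows "F w v"
  using assms
proof (induction v' arbitrary: P w w')
  case Nil
  then have "agree (-T) [] w'"
    using agree_append[of "-T" P w' "[]"] agree_sym by simp
  from agree_Nil[OF this] show ?case using Nil.prems by simp
next
  case (Cons d v')
  have ag: "agree (-T) (d # v') w'"
    using agree_append[of "-T" P w' "d # v'"] Cons.prems agree_sym by simp
  show ?case
  proof (cases "d \<in> T")
    case True
    then obtain w'' where "w' = d # w''"
      using agree_head[OF ag] by auto
    then show ?thesis using Cons.IH[of w "P @ [d]" w''] Cons.prems by simp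
  next
    case False
    then have "filter (\<lambda>a. a = d \<or> a \<notin> -T) (d # v') = filter (\<lambda>a. a = d \<or> a \<notin> -T) w'"
      using ag unfolding agree_def by blast
    then have f: "filter (\<lambda>a. a = d \<or> a \<in> T) w' = d # filter (\<lambda>a. a = d \<or> a \<in> T) v'"
      by simp
    \<comment> \<open>The filtered word begins with \<open>d\<close>, so no letter of
      \<open>T\<close> precedes the first \<open>d\<close> in \<open>w'\<close>: it lies in the
      current block.\<close>
    then obtain G B where w': "w' = G @ d # B" "\<forall>a\<in>set G. \<not> (a = d \<or> a \<in> T)"
      by (auto simp: filter_eq_Cons_iff)
    then have *: "E w (P @ d # G @ B)" "F w (P @ d # G @ B)" "agree (-T) (P @ d # G @ B) v"
      using move_left[OF Cons.prems(1,2) _ Cons.prems(4), of G B] Cons.prems(3) w' False by blast+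
    have "E (P @ d # G @ B) v" by (rule A.trans[OF A.sym[OF *(1)] Cons.prems(1)])
    then have "F (P @ d # G @ B) v"
      by (rule Cons.IH[of _ "P @ [d]" "G @ B"]) (use *(3) Cons.prems(4) in simp_all)
    with *(2) show ?thesis by (rule B.trans)
  qed
qed

end

section \<open>Elimination of common squares and of the degenerate theories\<close>

lemma nonadj_notin: "set w \<inter> M = {} \<Longrightarrow> nonadj M w"
  by (induction w rule: induct_list012) auto

lemma (in A'_theory) squared_if_commut:
  assumes commut "2 \<le> count_list w x"
  shows "squared w x"
proof -
  have "x \<in> set w" using assms(2) count_list_0_iff[of w x] by auto
  then obtain A w' where w: "w = A @ x # w'" "x \<notin> set A" by (meson split_list_first)
  then have "x \<in> set w'" using assms(2) count_list_0_iff[of A x] count_list_0_iff[of w' x] by auto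
  then obtain B C where "w' = B @ x # C" by (meson split_list)
  then show ?thesis
    using w by (intro squaredI[of w "[]" x "A @ B @ C"] commut_mset[OF assms(1)]) simp
qed

context theory_pair begin

text \<open>If the restrictions differed, \<open>E\<close> would contain an alternating identity
  short enough for each word without two \<open>x\<close> in a block. It passes to \<open>F\<close>
  as an isoterm pair, so \<open>x\<close> would be a square in both words.\<close>

lemma res_eq_if_not_squared:
  assumes nc: "\<not> A.commut" and E: "E u v" and x: "2 \<le> count_list u x"
    and nsq: "\<not> (B.squared u x \<and> B.squared v x)"
  shows "res (insert x (simple u)) u = res (insert x (simple v)) v"
    and "nonadj {x} (res (insert x (simple v)) v)"
proof -
  let ?u = "res (insert x (simple u)) u" and ?v = "res (insert x (simple v)) v"
  have nid: "\<not> E [Lx] [Lx, Lx]" using nc A.idem_imp_commut by blast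
  have nt: "\<not> E [] [Lx]" using nid A.totalD by blast
  have s: "simple u = simple v" by (rule A.simple_eq[OF nid E])
  have "x \<in> set v" using A.content_eq[OF nt E] x count_list_0_iff[of u x] by auto
  moreover have "x \<notin> simple v" using x unfolding s[symmetric] by (simp add: simple_def)
  ultimately have "count_list v x \<noteq> 0" "count_list v x \<noteq> 1"
    by (simp_all add: simple_def count_list_0_iff)
  then have x': "2 \<le> count_list v x" by linarith
  have adj: "nonadj {x} ?u \<or> nonadj {x} ?v"
    using B.squared_if_adjacent x x' nsq by blast
  show eq: "?u = ?v"
  proof (rule ccontr)
    assume ne: "?u \<noteq> ?v"
    obtain ts where ts: "distinct (x # ts)" "E (alt x ts) ([x, x] @ ts)"
      "nonadj {x} ?u \<Longrightarrow> Suc (length ts) \<le> count_list u x"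
      "nonadj {x} ?v \<Longrightarrow> Suc (length ts) \<le> count_list v x"
      using A.alt_square_if_res_differ[OF nc E x ne adj] by blast
    have "ts \<noteq> []"
    proof
      assume "ts = []"
      then have "E [x] [x, x]" using ts(2) by simp
      from A.substI[OF this, of "\<lambda>_. [Lx]"] show False using nid by simp
    qed
    then have F: "F (alt x ts) ([x, x] @ ts)"
      using transfer[OF isoterm_alt] ts(1,2) by blast
    have "B.squared u x"
      using B.squared_if_adjacent[OF x] B.squared_if_alt_square[OF ts(1) F] ts(3) by blast
    moreover have "B.squared v x"
      using B.squared_if_adjacent[OF x'] B.squared_if_alt_square[OF ts(1) F] ts(4) by blast
    ultimately show False using nsq by blast
  qed
  then show "nonadj {x} ?v" using adj by simp
qed

text \<open>Every multiple letter is distributed over the blocks in the same way in both words, so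
  they agree up to order inside blocks and \<open>sort_blocks\<close> applies.\<close>

lemma contained_no_square:
  assumes E: "E u v" and nc: "\<not> A.commut"
    and nsq: "\<And>x. x \<in> set u \<Longrightarrow> \<not> (B.squared u x \<and> B.squared v x)"
  shows "F u v"
proof -
  have nid: "\<not> E [Lx] [Lx, Lx]" using nc A.idem_imp_commut by blast
  have nt: "\<not> E [] [Lx]" using nid A.totalD by blast
  define T where "T = simple v"
  have s: "simple u = T" unfolding T_def by (rule A.simple_eq[OF nid E])
  have c: "set u = set v" by (rule A.content_eq[OF nt E])
  have multiple: "2 \<le> count_list w b" if "b \<in> set w" "b \<notin> simple w" for b w
  proof -
    have "count_list w b \<noteq> 0" "count_list w b \<noteq> 1"
      using that by (simp_all add: simple_def count_list_0_iff)
    then show ?thesis by linarith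
  qed
  have rT: "res T u = res T v"
    using A.simple_order_eq[OF nc E] s T_def by simp
  have ins: "filter (\<lambda>a. a = b \<or> a \<in> T) w = res (insert b T) w" for b w
    by (rule filter_cong) auto
  have main: "filter (\<lambda>a. a = b \<or> a \<in> T) u = filter (\<lambda>a. a = b \<or> a \<in> T) v \<and>
      nonadj {b} (filter (\<lambda>a. a = b \<or> a \<in> T) v)" if b: "b \<notin> T" for b
  proof (cases "b \<in> set u")
    case True
    then have "2 \<le> count_list u b" using multiple s b by simp
    from res_eq_if_not_squared[OF nc E this nsq[OF True]] show ?thesis
      unfolding ins using s T_def by simp
  next
    case False
    then have "filter (\<lambda>a. a = b \<or> a \<in> T) w = res T w" if "set w = set u" for w
      using that by (auto intro!: filter_cong)
    then have "filter (\<lambda>a. a = b \<or> a \<in> T) u = res T u" "filter (\<lambda>a. a = b \<or> a \<in> T) v = res T v"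
      using c by simp_all
    moreover have "nonadj {b} (res T v)" by (rule nonadj_notin) (use b in auto)
    ultimately show ?thesis using rT by simp
  qed
  interpret block_sorting E F T v
    by unfold_locales (use main multiple distinct_res_simple T_def in auto)
  have "agree (-T) u v"
    unfolding agree_def using rT main by simp
  from sort_blocks[OF E this, of "[]"] show ?thesis by simp
qed

text \<open>A letter that is a square in both words modulo \<open>F\<close> can be deleted, which
  gives the induction. Without such letters, the degenerate theories are handled by the first three
  isoterm pairs and the rest by \<open>contained_no_square\<close>.\<close>

theorem contained: "E u v \<Longrightarrow> F u v"
proof (induction "length u" arbitrary: u v rule: less_induct)
  case less
  note E = less.prems
  show ?case
  proof (cases "\<exists>x\<in>set u. B.squared u x \<and> B.squared v x")
    case True
    then obtain x where x: "x \<in> set u" "B.squared u x" "B.squared v x" by blast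
    let ?u = "filter (\<lambda>a. a \<noteq> x) u" and ?v = "filter (\<lambda>a. a \<noteq> x) v"
    have "length ?u < length u" using x(1) by (intro length_filter_less) auto
    then have "F ?u ?v" using less.hyps A.delete[OF E] by blast
    then have "F ([x, x] @ ?u) ([x, x] @ ?v)" using B.cong[of ?u ?v "[x, x]" "[]"] by simp
    then show ?thesis
      using x(2,3) B.trans B.sym unfolding B.squared_def by meson
  next
    case False
    then have nsq: "\<And>x. x \<in> set u \<Longrightarrow> \<not> (B.squared u x \<and> B.squared v x)" by blast
    consider (trivial) "E [] [Lx]" | (idem) "E [Lx] [Lx, Lx]" "\<not> E [] [Lx]"
      | (commut) "A.commut" "\<not> E [Lx] [Lx, Lx]" | (none) "\<not> A.commut" by blast
    then show ?thesis
    proof cases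
      case trivial
      then show ?thesis using transfer[OF isoterm_trivial] B.totalD by blast
    next
      case idem
      then have "F [Lx] [Lx, Lx]" using transfer[OF isoterm_idem] by blast
      then have Fx: "F [x] [x, x]" for x
        using B.substI[of "[Lx]" "[Lx, Lx]" "\<lambda>_. [x]"] by simp
      have sq: "B.squared w x" if "x \<in> set w" for w x
      proof -
        from split_list[OF that] obtain A B where "w = A @ x # B" by blast
        then show ?thesis using B.cong[OF Fx[of x], of A B] by (intro B.squaredI[of w A x B]) simp
      qed
      have "set u = set v" by (rule A.content_eq[OF idem(2) E])
      then have "u = []" using nsq[of "hd u"] sq[of "hd u"] by (cases u) auto
      then show ?thesis using \<open>set u = set v\<close> by simp
    next
      case commut
      have Fc: "B.commut"
        using transfer[OF isoterm_commut] commut(1) unfolding A.commut_def B.commut_def by blast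
      have nt: "\<not> E [] [Lx]" using commut(2) A.totalD by blast
      have s: "simple u = simple v" by (rule A.simple_eq[OF commut(2) E])
      have c: "set u = set v" by (rule A.content_eq[OF nt E])
      \<comment> \<open>In a commutative theory every multiple letter is a square, so none is left
        and both words are arrangements of one set.\<close>
      have "simple u = set u"
      proof (intro subset_antisym subsetI)
        fix x assume "x \<in> simple u"
        then show "x \<in> set u" using count_list_0_iff[of u x] by (auto simp: simple_def)
      next
        fix x assume x: "x \<in> set u"
        show "x \<in> simple u"
        proof (rule ccontr)
          assume "x \<notin> simple u"
          then have "count_list w x \<noteq> 0 \<and> count_list w x \<noteq> 1" if "w = u \<or> w = v" for w
            using that x s c by (auto simp: simple_def count_list_0_iff)
          then have "2 \<le> count_list u x" "2 \<le> count_list v x"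
            by (metis One_nat_def less_2_cases not_le)+
          then show False using B.squared_if_commut[OF Fc] nsq[OF x] by blast
        qed
      qed
      moreover have "distinct w" if "simple w = set w" for w
        using distinct_res_simple[of w] that by simp
      ultimately have "mset u = mset v"
        using s c by (simp add: set_eq_iff_mset_eq_distinct[symmetric])
      then show ?thesis by (rule B.commut_mset[OF Fc])
    next
      case none
      then show ?thesis using contained_no_square[OF E _ nsq] by blast
    qed
  qed
qed

end

section \<open>Varieties and their theories\<close>

lemma word_value_simps [simp]:
  "word_value M \<phi> [] = \<one>\<^bsub>M\<^esub>" "word_value M \<phi> (a # w) = \<phi> a \<otimes>\<^bsub>M\<^esub> word_value M \<phi> w"
  by (simp_all add: word_value_def)

lemma (in monoid) word_value_closed [simp]:
  "\<phi> \<in> UNIV \<rightarrow> carrier G \<Longrightarrow> word_value G \<phi> w \<in> carrier G"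
  by (induction w) auto

lemma (in monoid) word_value_append:
  "\<phi> \<in> UNIV \<rightarrow> carrier G \<Longrightarrow> word_value G \<phi> (u @ v) = word_value G \<phi> u \<otimes> word_value G \<phi> v"
  by (induction u) (auto simp: m_assoc Pi_iff)

lemma (in monoid) word_value_subst:
  "\<phi> \<in> UNIV \<rightarrow> carrier G \<Longrightarrow>
    word_value G \<phi> (subst s w) = word_value G (\<lambda>a. word_value G \<phi> (s a)) w"
  by (induction w) (auto simp: word_value_append)

definition theory_of :: "'a monoid set \<Rightarrow> word \<Rightarrow> word \<Rightarrow> bool"
  where "theory_of V u v \<longleftrightarrow> (\<forall>M\<in>V. satisfies M (u, v))"

lemma satisfies_refl: "satisfies M (u, u)"
  by (simp add: satisfies_def)

lemma A'_theory_theory_of: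
  assumes "V \<subseteq> variety_A'"
  shows "A'_theory (theory_of V)"
proof
  have mon: "monoid M" if "M \<in> V" for M
    using assms that by (auto simp: variety_A'_def variety_of_def)
  fix u v w p q s
  show "theory_of V u u" by (simp add: theory_of_def satisfies_refl)
  show "theory_of V u v \<Longrightarrow> theory_of V v u" by (simp add: theory_of_def satisfies_def)
  show "theory_of V u v \<Longrightarrow> theory_of V v w \<Longrightarrow> theory_of V u w"
    by (simp add: theory_of_def satisfies_def)
  show "theory_of V u v \<Longrightarrow> theory_of V (p @ u @ q) (p @ v @ q)"
    using mon by (simp add: theory_of_def satisfies_def monoid.word_value_append)
  show "theory_of V u v \<Longrightarrow> theory_of V (subst s u) (subst s v)"
    using mon
    by (simp add: theory_of_def satisfies_def monoid.word_value_subst monoid.word_value_closed Pi_iff)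
  show "(u, v) \<in> A'_identities \<Longrightarrow> theory_of V u v"
    using assms by (auto simp: theory_of_def variety_A'_def variety_of_def)
qed

text \<open>The relatively free monoid of countable rank, transported into the infinite type.\<close>

lemma free_monoid_exists:
  assumes inf: "infinite (UNIV :: 'a set)" and "A'_theory E"
  obtains M :: "'a monoid" where "monoid M" "\<And>u v. satisfies M (u, v) \<longleftrightarrow> E u v"
proof -
  interpret A'_theory E by fact
  obtain f :: "nat \<Rightarrow> 'a" where f: "inj f"
    using infinite_countable_subset[OF inf] by blast
  \<comment> \<open>The chosen representative depends only on the class of \<open>u\<close>, so
    \<open>c u\<close> is a code of that class in the infinite type.\<close>
  define c where "c u = f (to_nat (SOME v. E u v))" for u
  have c: "c u = c v \<longleftrightarrow> E u v" for u v
  proof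
    assume "c u = c v"
    then have "(SOME w. E u w) = (SOME w. E v w)"
      using f unfolding c_def by (simp add: inj_eq)
    moreover have "E u (SOME w. E u w)" for u by (rule someI[of "E u" u]) simp
    ultimately show "E u v" using trans sym by metis
  next
    assume "E u v"
    then have "E u = E v" using trans sym by blast
    then show "c u = c v" by (simp add: c_def)
  qed
  define r where "r a = (SOME u. c u = a)" for a
  have r: "E (r (c u)) u" for u
  proof -
    have "c (r (c u)) = c u" unfolding r_def by (rule someI) (rule HOL.refl)
    then show ?thesis by (simp add: c)
  qed
  define M where "M = \<lparr>carrier = range c, monoid.mult = (\<lambda>a b. c (r a @ r b)), one = c []\<rparr>"
  have mult: "c u \<otimes>\<^bsub>M\<^esub> c v = c (u @ v)" for u v
    by (simp add: M_def c cong_append r)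
  have mon: "monoid M"
    by (rule monoidI) (auto simp: M_def mult[unfolded M_def, simplified])
  have val: "word_value M (\<lambda>a. c (s a)) w = c (subst s w)" for s w
    by (induction w) (simp_all add: mult, simp add: M_def)
  have "satisfies M (u, v) \<longleftrightarrow> E u v" for u v
  proof
    assume "satisfies M (u, v)"
    moreover have "(\<lambda>a. c [a]) \<in> UNIV \<rightarrow> carrier M" by (simp add: M_def)
    ultimately have "c (subst (\<lambda>a. [a]) u) = c (subst (\<lambda>a. [a]) v)"
      unfolding satisfies_def using val[of "\<lambda>a. [a]"] by force
    then show "E u v" by (simp add: c subst_def)
  next
    assume uv: "E u v"
    show "satisfies M (u, v)"
      unfolding satisfies_def
    proof
      fix \<phi> :: "letter \<Rightarrow> 'a" assume "\<phi> \<in> UNIV \<rightarrow> carrier M"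
      then have "\<forall>a. \<exists>w. \<phi> a = c w" by (auto simp: M_def)
      then obtain s where "\<phi> = (\<lambda>a. c (s a))" by metis
      then show "word_value M \<phi> (fst (u, v)) = word_value M \<phi> (snd (u, v))"
        by (simp add: val c substI[OF uv])
    qed
  qed
  with mon show ?thesis by (rule that)
qed

section \<open>Correspondence between varieties and identities, and joins of varieties\<close>

definition identities_of :: "'a monoid set \<Rightarrow> identity set"
  where "identities_of V = {(u, v). theory_of V u v}"

lemma variety_of_identities_of: "monoid_variety V \<Longrightarrow> variety_of (identities_of V) = V"
  unfolding monoid_variety_def variety_of_def identities_of_def theory_of_def by fastforce

lemma identities_of_antimono: "V \<subseteq> W \<Longrightarrow> identities_of W \<subseteq> identities_of V"
  by (auto simp: identities_of_def theory_of_def)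

lemma variety_of_antimono: "\<Sigma> \<subseteq> \<Sigma>' \<Longrightarrow> variety_of \<Sigma>' \<subseteq> variety_of \<Sigma>"
  by (auto simp: variety_of_def)

lemma variety_of_Un: "variety_of (\<Sigma> \<union> \<Sigma>') = variety_of \<Sigma> \<inter> variety_of \<Sigma>'"
  by (auto simp: variety_of_def)

text \<open>The relatively free monoid of the join \<open>J\<close> of both theories lies in
  \<open>V\<close> and in \<open>W\<close>, so \<open>J\<close> contains the pair. If the pair
  failed in both varieties, every step of \<open>J\<close> starting from \<open>w\<close> would stay
  at \<open>w\<close>.\<close>

lemma isoterm_pair_Int:
  fixes V W :: "'a monoid set"
  assumes inf: "infinite (UNIV :: 'a set)"
    and V: "monoid_variety V" "V \<subseteq> variety_A'" and W: "monoid_variety W" "W \<subseteq> variety_A'"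
    and iso: "isoterm_pair w w'" and VW: "theory_of (V \<inter> W) w w'"
  shows "theory_of V w w' \<or> theory_of W w w'"
proof (rule ccontr)
  assume neg: "\<not> ?thesis"
  interpret V: A'_theory "theory_of V" by (rule A'_theory_theory_of) fact
  interpret W: A'_theory "theory_of W" by (rule A'_theory_theory_of) fact
  define J where "J = (\<lambda>u v. theory_of V u v \<or> theory_of W u v)\<^sup>*\<^sup>*"
  have J: "A'_theory J"
  proof
    fix u v x p q s
    show "J u u" by (simp add: J_def)
    show "J u v \<Longrightarrow> J v u"
      unfolding J_def
      by (rule sympD[OF symp_rtranclp]) (auto intro!: sympI dest: V.sym W.sym)
    show "J u v \<Longrightarrow> J v x \<Longrightarrow> J u x" by (simp add: J_def)
    show "J (p @ u @ q) (p @ v @ q)" if "J u v"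
      using that unfolding J_def
      by (induction rule: rtranclp_induct) (auto intro: V.cong W.cong rtranclp.rtrancl_into_rtrancl)
    show "J (subst s u) (subst s v)" if "J u v"
      using that unfolding J_def
      by (induction rule: rtranclp_induct) (auto intro: V.substI W.substI rtranclp.rtrancl_into_rtrancl)
    show "J u v" if "(u, v) \<in> A'_identities"
      using V.ax[OF that] unfolding J_def by blast
  qed
  obtain M :: "'a monoid" where M: "monoid M" "\<And>u v. satisfies M (u, v) \<longleftrightarrow> J u v"
    using free_monoid_exists[OF inf J] by blast
  have "M \<in> variety_of (identities_of V)" "M \<in> variety_of (identities_of W)"
    using M by (auto simp: variety_of_def identities_of_def J_def)
  then have "M \<in> V \<inter> W"
    using variety_of_identities_of V(1) W(1) by blast
  then have "J w w'" using VW M(2) by (auto simp: theory_of_def)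
  moreover have "v = w" if "J w v" for v
    using that unfolding J_def
  proof (induction rule: rtranclp_induct)
    case (step y z)
    have "A'_theory (theory_of V)" "A'_theory (theory_of W)"
      using V.A'_theory_axioms W.A'_theory_axioms by auto
    then show ?case using step iso neg unfolding isoterm_pair_def by blast
  qed simp
  ultimately show False using neg by auto
qed

definition variety_join :: "'a monoid set \<Rightarrow> 'a monoid set \<Rightarrow> 'a monoid set"
  where "variety_join V W = variety_of (identities_of V \<inter> identities_of W)"

text \<open>The nontrivial half of distributivity. By \<open>contained\<close> only isoterm pairs
  matter, and for these \<open>isoterm_pair_Int\<close> turns meets into disjunctions, so the claim
  becomes distributivity of "or" over "and".\<close>

lemma Int_variety_join_subset:
  fixes V W U :: "'a monoid set"
  assumes inf: "infinite (UNIV :: 'a set)"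
    and V: "monoid_variety V" "V \<subseteq> variety_A'" and W: "monoid_variety W" "W \<subseteq> variety_A'"
    and U: "monoid_variety U" "U \<subseteq> variety_A'"
  shows "V \<inter> variety_join W U \<subseteq> variety_join (V \<inter> W) (V \<inter> U)"
proof -
  let ?L = "V \<inter> variety_join W U"
  let ?E = "\<lambda>u v. theory_of (V \<inter> W) u v \<and> theory_of (V \<inter> U) u v"
  \<comment> \<open>The union need not be a variety, but \<open>A'_theory_theory_of\<close> applies
    to any set of monoids inside \<open>variety_A'\<close>.\<close>
  have E: "?E = theory_of ((V \<inter> W) \<union> (V \<inter> U))"
    by (auto simp: theory_of_def fun_eq_iff)
  have "theory_pair ?E (theory_of ?L)"
  proof (intro theory_pair.intro theory_pair_axioms.intro)
    show "A'_theory ?E" "A'_theory (theory_of ?L)"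
      unfolding E by (rule A'_theory_theory_of; use V in blast)+
    fix w w' assume iso: "isoterm_pair w w'" and "?E w w'"
    then have "theory_of V w w' \<or> (theory_of W w w' \<and> theory_of U w w')"
      using isoterm_pair_Int[OF inf V W iso] isoterm_pair_Int[OF inf V U iso] by blast
    then show "theory_of ?L w w'"
      by (auto simp: theory_of_def variety_join_def variety_of_def identities_of_def)
  qed
  then have *: "?E u v \<Longrightarrow> theory_of ?L u v" for u v
    by (rule theory_pair.contained)
  have mon: "monoid M" if "M \<in> V" for M
    using V(2) that by (auto simp: variety_A'_def variety_of_def)
  show ?thesis
  proof
    fix M assume M: "M \<in> ?L"
    then have "satisfies M (u, v)" if "?E u v" for u v
      using *[OF that] by (simp only: theory_of_def)
    then show "M \<in> variety_join (V \<inter> W) (V \<inter> U)"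
      using M mon unfolding variety_join_def variety_of_def identities_of_def by auto
  qed
qed

lemma variety_join_closed:
  assumes "V \<subseteq> variety_A'" "W \<subseteq> variety_A'"
  shows "monoid_variety (variety_join V W)" "variety_join V W \<subseteq> variety_A'"
proof -
  show "monoid_variety (variety_join V W)"
    by (auto simp: monoid_variety_def variety_join_def)
  have "A'_identities \<subseteq> identities_of V \<inter> identities_of W"
    using assms by (auto simp: identities_of_def theory_of_def variety_A'_def variety_of_def)
  then show "variety_join V W \<subseteq> variety_A'"
    unfolding variety_join_def variety_A'_def by (rule variety_of_antimono)
qed

lemma variety_join_upper:
  assumes "V \<subseteq> variety_A'" "W \<subseteq> variety_A'"
  shows "V \<subseteq> variety_join V W" "W \<subseteq> variety_join V W"
  using assms
  by (fastforce simp: variety_join_def variety_of_def identities_of_def theory_of_def variety_A'_def)+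

lemma variety_join_least:
  assumes "monoid_variety U" "V \<subseteq> U" "W \<subseteq> U"
  shows "variety_join V W \<subseteq> U"
proof -
  have "variety_join V W \<subseteq> variety_of (identities_of U)"
    unfolding variety_join_def
    using identities_of_antimono assms(2,3) by (intro variety_of_antimono) blast
  then show ?thesis using variety_of_identities_of[OF assms(1)] by simp
qed

lemma monoid_variety_Int: "monoid_variety V \<Longrightarrow> monoid_variety W \<Longrightarrow> monoid_variety (V \<inter> W)"
  unfolding monoid_variety_def using variety_of_Un by blast

section \<open>Intersection and \<open>variety_join\<close> as the lattice operations\<close>

theorem proposition3p15:
  assumes "infinite (UNIV :: 'a set)"
  shows "distributive_lattice (subvarieties (variety_A' :: 'a monoid set))"
proof -
  let ?L = "subvarieties (variety_A' :: 'a monoid set)"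
  have carrier: "V \<in> carrier ?L \<longleftrightarrow> monoid_variety V \<and> V \<subseteq> variety_A'" for V
    by (simp add: subvarieties_def)
  have le: "V \<sqsubseteq>\<^bsub>?L\<^esub> W \<longleftrightarrow> V \<subseteq> W" for V W
    by (simp add: subvarieties_def)
  have lub: "least ?L (variety_join V W) (Upper ?L {V, W})"
    if VW: "V \<in> carrier ?L" "W \<in> carrier ?L" for V W
    unfolding least_def
  proof (intro conjI ballI)
    have V: "V \<subseteq> variety_A'" and W: "W \<subseteq> variety_A'" using VW by (simp_all add: carrier)
    show "Upper ?L {V, W} \<subseteq> carrier ?L" by (auto simp: Upper_def)
    show "variety_join V W \<in> Upper ?L {V, W}"
      using variety_join_closed[OF V W] variety_join_upper[OF V W] by (auto simp: Upper_def carrier le)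
    fix U assume "U \<in> Upper ?L {V, W}"
    then have "monoid_variety U" "V \<subseteq> U" "W \<subseteq> U"
      using VW by (auto simp: Upper_def carrier le)
    then show "variety_join V W \<sqsubseteq>\<^bsub>?L\<^esub> U"
      unfolding le by (rule variety_join_least)
  qed
  have glb: "greatest ?L (V \<inter> W) (Lower ?L {V, W})"
    if "V \<in> carrier ?L" "W \<in> carrier ?L" for V W
    using that by (auto simp: greatest_def Lower_def carrier le intro: monoid_variety_Int)
  interpret partial_order ?L
    by unfold_locales (auto simp: subvarieties_def)
  interpret lattice ?L
    by unfold_locales (use lub glb in blast)+
  have join: "V \<squnion>\<^bsub>?L\<^esub> W = variety_join V W" if "V \<in> carrier ?L" "W \<in> carrier ?L" for V W
    by (rule joinI[where P = "\<lambda>l. l = variety_join V W"])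
       (use that least_unique[OF _ lub[OF that]] in blast)+
  have meet: "V \<sqinter>\<^bsub>?L\<^esub> W = V \<inter> W" if "V \<in> carrier ?L" "W \<in> carrier ?L" for V W
    by (rule meetI[where P = "\<lambda>l. l = V \<inter> W"])
       (use that greatest_unique[OF _ glb[OF that]] in blast)+
  show ?thesis
  proof unfold_locales
    fix x y z
    assume xyz: "x \<in> carrier ?L" "y \<in> carrier ?L" "z \<in> carrier ?L"
    have c: "variety_join y z \<in> carrier ?L" "x \<inter> y \<in> carrier ?L" "x \<inter> z \<in> carrier ?L"
      using xyz variety_join_closed[of y z] monoid_variety_Int by (auto simp: carrier)
    have "x \<inter> variety_join y z = variety_join (x \<inter> y) (x \<inter> z)"
    proof
      show "x \<inter> variety_join y z \<subseteq> variety_join (x \<inter> y) (x \<inter> z)"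
        using xyz by (intro Int_variety_join_subset[OF assms]) (auto simp: carrier)
      show "variety_join (x \<inter> y) (x \<inter> z) \<subseteq> x \<inter> variety_join y z"
        using xyz c variety_join_upper[of y z]
        by (intro variety_join_least monoid_variety_Int) (auto simp: carrier)
    qed
    then show "x \<sqinter>\<^bsub>?L\<^esub> (y \<squnion>\<^bsub>?L\<^esub> z) = (x \<sqinter>\<^bsub>?L\<^esub> y) \<squnion>\<^bsub>?L\<^esub> (x \<sqinter>\<^bsub>?L\<^esub> z)"
      using xyz c by (simp add: join meet)
  qed
qed

end
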